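(* Let $F\dashv G$ be an adjunction with $F\colon\mathcal{C}\to\mathcal{D}$ and $G\colon\mathcal{D}\to\mathcal{C}$, let $I$ be an object of $\mathcal{C}$ and $O$ an object of $\mathcal{D}$. Let $\mathcal{L}_{\mathcal{C}}$ be a $(\mathcal{C},I,GO)$-language and $\mathcal{L}_{\mathcal{D}}$ a $(\mathcal{D},FI,O)$-language such that $\mathcal{L}_{\mathcal{D}}=(\mathcal{L}_{\mathcal{C}})^*$. Then the adjunction $F\dashv G$ lifts to an adjunction $\overline{F}\dashv\overline{G}$ with $\overline{F}\colon\mathsf{Auto}(\mathcal{L}_{\mathcal{C}})\to\mathsf{Auto}(\mathcal{L}_{\mathcal{D}})$ and $\overline{G}\colon\mathsf{Auto}(\mathcal{L}_{\mathcal{D}})\to\mathsf{Auto}(\mathcal{L}_{\mathcal{C}})$. The lifted functors are defined as $F$, respectively $G$, on the state object, that is, $\mathsf{State}\circ\overline{F}=F\circ\mathsf{State}$ and $\mathsf{State}\circ\overline{G}=G\circ\mathsf{State}$.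
   Context: Fix a set $A$ (alphabet). The category $\mathcal{I}_{\mathsf{word}}$ has three objects $\mathsf{in},\mathsf{states},\mathsf{out}$ and is freely generated by arrows $\triangleright\colon\mathsf{in}\to\mathsf{states}$, $a\colon\mathsf{states}\to\mathsf{states}$ for each $a\in A$, and $\triangleleft\colon\mathsf{states}\to\mathsf{out}$. Composition is written left to right as concatenation; thus the arrows $\mathsf{states}\to\mathsf{states}$ are the words $w\in A^*$ and the arrows $\mathsf{in}\to\mathsf{out}$ are the $\triangleright w\triangleleft$, $w\in A^*$. $\mathcal{O}_{\mathsf{word}}$ is the full subcategory on $\mathsf{in},\mathsf{out}$, with inclusion $\iota$. For a category $\mathcal{K}$ and objects $X,Y$ of it, a $(\mathcal{K},X,Y)$-language is a functor $\mathcal{L}\colon\mathcal{O}_{\mathsf{word}}\to\mathcal{K}$ with $\mathcal{L}(\mathsf{in})=X$, $\mathcal{L}(\mathsf{out})=Y$. The category $\mathsf{Auto}(\mathcal{L})$ has as objects the functors $\mathcal{A}\colon\mathcal{I}_{\mathsf{word}}\to\mathcal{K}$ with $\mathcal{A}\circ\iota=\mathcal{L}$, and as arrows the natural transformations $\alpha$ with $\alpha\circ\iota=\mathrm{id}_{\mathcal{L}}$. The functor $\mathsf{State}\colon\mathsf{Auto}(\mathcal{L})\to\mathcal{K}$ is evaluation at $\mathsf{states}$: $\mathcal{A}\mapsto\mathcal{A}(\mathsf{states})$. Let $(-)^*\colon\mathcal{C}(X,GY)\to\mathcal{D}(FX,Y)$ denote the adjunction bijection. For a $(\mathcal{C},I,GO)$-language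 $\mathcal{L}$, the $(\mathcal{D},FI,O)$-language $\mathcal{L}^*$ is defined by $\mathcal{L}^*(\triangleright w\triangleleft)=(\mathcal{L}(\triangleright w\triangleleft))^*$ for all $w\in A^*$. *)

theory Defs
  imports Main "HOL-Library.FuncSet"
begin

text \<open>Composition is written in diagrammatic order throughout: \<open>f \<Zsemi>\<^bsub>C\<^esub> g\<close> is
  ``first \<open>f\<close>, then \<open>g\<close>''.\<close>

record ('o, 'm) cat =
  Ob :: "'o set"
  Ar :: "'m set"
  Dom :: "'m \<Rightarrow> 'o"
  Cod :: "'m \<Rightarrow> 'o"
  Id :: "'o \<Rightarrow> 'm"
  Comp :: "'m \<Rightarrow> 'm \<Rightarrow> 'm" (infixl "\<Zsemi>\<index>" 70)

definition hom :: "('o, 'm) cat \<Rightarrow> 'o \<Rightarrow> 'o \<Rightarrow> 'm set" where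
  "hom C x y = {f \<in> Ar C. Dom C f = x \<and> Cod C f = y}"

locale category =
  fixes C :: "('o, 'm) cat"
  assumes Dom_in_Ob: "f \<in> Ar C \<Longrightarrow> Dom C f \<in> Ob C"
    and Cod_in_Ob: "f \<in> Ar C \<Longrightarrow> Cod C f \<in> Ob C"
    and Id_in_hom: "x \<in> Ob C \<Longrightarrow> Id C x \<in> hom C x x"
    and Comp_in_hom: "\<lbrakk>f \<in> hom C x y; g \<in> hom C y z\<rbrakk> \<Longrightarrow> f \<Zsemi>\<^bsub>C\<^esub> g \<in> hom C x z"
    and Id_left: "f \<in> hom C x y \<Longrightarrow> Id C x \<Zsemi>\<^bsub>C\<^esub> f = f"
    and Id_right: "f \<in> hom C x y \<Longrightarrow> f \<Zsemi>\<^bsub>C\<^esub> Id C y = f"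
    and Comp_assoc: "\<lbrakk>f \<in> hom C w x; g \<in> hom C x y; h \<in> hom C y z\<rbrakk> \<Longrightarrow>
      (f \<Zsemi>\<^bsub>C\<^esub> g) \<Zsemi>\<^bsub>C\<^esub> h = f \<Zsemi>\<^bsub>C\<^esub> (g \<Zsemi>\<^bsub>C\<^esub> h)"

text \<open>Functors and natural transformations are extensional (\<open>undefined\<close> outside the
  carriers), so that HOL equality is the intended strict equality of functors,
  respectively of natural transformations.\<close>

record ('o, 'm, 'p, 'n) fctr =
  FOb :: "'o \<Rightarrow> 'p"
  FAr :: "'m \<Rightarrow> 'n"

locale is_functor = dom: category C + cod: category D
  for C :: "('o, 'm) cat" and D :: "('p, 'n) cat" +
  fixes F :: "('o, 'm, 'p, 'n) fctr"
  assumes FOb_ext: "FOb F \<in> Ob C \<rightarrow>\<^sub>E Ob D"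
    and FAr_ext: "FAr F \<in> Ar C \<rightarrow>\<^sub>E Ar D"
    and FAr_hom: "f \<in> hom C x y \<Longrightarrow> FAr F f \<in> hom D (FOb F x) (FOb F y)"
    and FAr_Id: "x \<in> Ob C \<Longrightarrow> FAr F (Id C x) = Id D (FOb F x)"
    and FAr_Comp: "\<lbrakk>f \<in> hom C x y; g \<in> hom C y z\<rbrakk> \<Longrightarrow>
      FAr F (f \<Zsemi>\<^bsub>C\<^esub> g) = FAr F f \<Zsemi>\<^bsub>D\<^esub> FAr F g"

text \<open>\<open>functor_comp C G F\<close> is the composite \<open>G \<circ> F\<close>, where \<open>C\<close> is the domain of \<open>F\<close>.\<close>

definition functor_comp :: "('o, 'm) cat \<Rightarrow> ('p, 'n, 'q, 'r) fctr \<Rightarrow> ('o, 'm, 'p, 'n) fctr \<Rightarrow>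
    ('o, 'm, 'q, 'r) fctr" where
  "functor_comp C G F = \<lparr>FOb = compose (Ob C) (FOb G) (FOb F), FAr = compose (Ar C) (FAr G) (FAr F)\<rparr>"

definition full_subcat :: "('o, 'm) cat \<Rightarrow> 'o set \<Rightarrow> ('o, 'm) cat" where
  "full_subcat C S = C\<lparr>Ob := Ob C \<inter> S, Ar := {f \<in> Ar C. Dom C f \<in> S \<and> Cod C f \<in> S}\<rparr>"

definition inclusion :: "('o, 'm) cat \<Rightarrow> ('o, 'm, 'o, 'm) fctr" where
  "inclusion B = \<lparr>FOb = (\<lambda>x\<in>Ob B. x), FAr = (\<lambda>f\<in>Ar B. f)\<rparr>"

record ('o, 'm, 'p, 'n) ntrans =
  NDom :: "('o, 'm, 'p, 'n) fctr"
  NCod :: "('o, 'm, 'p, 'n) fctr"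
  At :: "'o \<Rightarrow> 'n"

locale is_ntrans = src: is_functor C D "NDom \<tau>" + tgt: is_functor C D "NCod \<tau>"
  for C :: "('o, 'm) cat" and D :: "('p, 'n) cat" and \<tau> :: "('o, 'm, 'p, 'n) ntrans" +
  assumes At_ext: "At \<tau> \<in> extensional (Ob C)"
    and At_hom: "x \<in> Ob C \<Longrightarrow> At \<tau> x \<in> hom D (FOb (NDom \<tau>) x) (FOb (NCod \<tau>) x)"
    and At_natural: "f \<in> hom C x y \<Longrightarrow>
      FAr (NDom \<tau>) f \<Zsemi>\<^bsub>D\<^esub> At \<tau> y = At \<tau> x \<Zsemi>\<^bsub>D\<^esub> FAr (NCod \<tau>) f"

definition id_ntrans :: "('o, 'm) cat \<Rightarrow> ('p, 'n) cat \<Rightarrow> ('o, 'm, 'p, 'n) fctr \<Rightarrow>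
    ('o, 'm, 'p, 'n) ntrans" where
  "id_ntrans C D F = \<lparr>NDom = F, NCod = F, At = (\<lambda>x\<in>Ob C. Id D (FOb F x))\<rparr>"

definition vcomp :: "('o, 'm) cat \<Rightarrow> ('p, 'n) cat \<Rightarrow> ('o, 'm, 'p, 'n) ntrans \<Rightarrow>
    ('o, 'm, 'p, 'n) ntrans \<Rightarrow> ('o, 'm, 'p, 'n) ntrans" where
  "vcomp C D \<sigma> \<tau> = \<lparr>NDom = NDom \<sigma>, NCod = NCod \<tau>, At = (\<lambda>x\<in>Ob C. At \<sigma> x \<Zsemi>\<^bsub>D\<^esub> At \<tau> x)\<rparr>"

text \<open>\<open>whisker B \<tau> H\<close> is \<open>\<tau> \<circ> H\<close>, where \<open>B\<close> is the domain of the functor \<open>H\<close>.\<close>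

definition whisker :: "('o, 'm) cat \<Rightarrow> ('p, 'n, 'q, 'r) ntrans \<Rightarrow> ('o, 'm, 'p, 'n) fctr \<Rightarrow>
    ('o, 'm, 'q, 'r) ntrans" where
  "whisker B \<tau> H =
    \<lparr>NDom = functor_comp B (NDom \<tau>) H, NCod = functor_comp B (NCod \<tau>) H, At = compose (Ob B) (At \<tau>) (FOb H)\<rparr>"

definition functor_cat :: "('o, 'm) cat \<Rightarrow> ('p, 'n) cat \<Rightarrow>
    (('o, 'm, 'p, 'n) fctr, ('o, 'm, 'p, 'n) ntrans) cat" where
  "functor_cat C D =
    \<lparr>Ob = {F. is_functor C D F}, Ar = {\<tau>. is_ntrans C D \<tau>}, Dom = NDom, Cod = NCod,
     Id = id_ntrans C D, Comp = vcomp C D\<rparr>"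

text \<open>An adjunction \<open>F \<stileturn> G\<close>, given by its bijections
  \<open>\<phi> X Y : C(X, G Y) \<rightarrow> D(F X, Y)\<close>, natural in \<open>X\<close> and \<open>Y\<close>.\<close>

locale adjunction = left: is_functor C D F + right: is_functor D C G
  for C :: "('o, 'm) cat" and D :: "('p, 'n) cat"
    and F :: "('o, 'm, 'p, 'n) fctr" and G :: "('p, 'n, 'o, 'm) fctr" +
  fixes \<phi> :: "'o \<Rightarrow> 'p \<Rightarrow> 'm \<Rightarrow> 'n"
  assumes transpose_bij: "\<lbrakk>X \<in> Ob C; Y \<in> Ob D\<rbrakk> \<Longrightarrow>
      bij_betw (\<phi> X Y) (hom C X (FOb G Y)) (hom D (FOb F X) Y)"
    and transpose_natural:
      "\<lbrakk>X \<in> Ob C; X' \<in> Ob C; Y \<in> Ob D; Y' \<in> Ob D;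
        h \<in> hom C X' X; f \<in> hom C X (FOb G Y); k \<in> hom D Y Y'\<rbrakk> \<Longrightarrow>
      \<phi> X' Y' (h \<Zsemi>\<^bsub>C\<^esub> f \<Zsemi>\<^bsub>C\<^esub> FAr G k) = FAr F h \<Zsemi>\<^bsub>D\<^esub> \<phi> X Y f \<Zsemi>\<^bsub>D\<^esub> k"

record ('v, 'e) quiver =
  Vert :: "'v set"
  Edge :: "'e set"
  Src :: "'e \<Rightarrow> 'v"
  Tgt :: "'e \<Rightarrow> 'v"

fun path :: "('v, 'e) quiver \<Rightarrow> 'v \<Rightarrow> 'e list \<Rightarrow> 'v \<Rightarrow> bool" where
  "path Q x [] y \<longleftrightarrow> x \<in> Vert Q \<and> x = y"
| "path Q x (e # p) y \<longleftrightarrow> x \<in> Vert Q \<and> e \<in> Edge Q \<and> Src Q e = x \<and> path Q (Tgt Q e) p y"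

definition free_cat :: "('v, 'e) quiver \<Rightarrow> ('v, 'v \<times> 'e list \<times> 'v) cat" where
  "free_cat Q =
    \<lparr>Ob = Vert Q, Ar = {(x, p, y). path Q x p y},
     Dom = (\<lambda>(x, p, y). x), Cod = (\<lambda>(x, p, y). y),
     Id = (\<lambda>x. (x, [], x)), Comp = (\<lambda>(x, p, y) (x', q, y'). (x, p @ q, y'))\<rparr>"

datatype word_ob = In | States | Out

datatype 'a word_gen = Start | Letter 'a | End

fun word_src :: "'a word_gen \<Rightarrow> word_ob" where
  "word_src Start = In"
| "word_src (Letter a) = States"
| "word_src End = States"

fun word_tgt :: "'a word_gen \<Rightarrow> word_ob" where
  "word_tgt Start = States"
| "word_tgt (Letter a) = States"
| "word_tgt End = Out"

type_synonym 'a word_arr = "word_ob \<times> 'a word_gen list \<times> word_ob"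

text \<open>The alphabet is a set \<open>A\<close> rather than a type, so that it may be empty.\<close>

definition I_word :: "'a set \<Rightarrow> (word_ob, 'a word_arr) cat" where
  "I_word A = free_cat
    \<lparr>Vert = {In, States, Out}, Edge = {Start, End} \<union> Letter ` A, Src = word_src, Tgt = word_tgt\<rparr>"

definition O_word :: "'a set \<Rightarrow> (word_ob, 'a word_arr) cat" where
  "O_word A = full_subcat (I_word A) {In, Out}"

definition word_incl :: "'a set \<Rightarrow> (word_ob, 'a word_arr, word_ob, 'a word_arr) fctr" where
  "word_incl A = inclusion (O_word A)"

type_synonym ('a, 'o, 'm) word_fctr = "(word_ob, 'a word_arr, 'o, 'm) fctr"
type_synonym ('a, 'o, 'm) word_ntrans = "(word_ob, 'a word_arr, 'o, 'm) ntrans"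

definition is_language :: "'a set \<Rightarrow> ('o, 'm) cat \<Rightarrow> 'o \<Rightarrow> 'o \<Rightarrow> ('a, 'o, 'm) word_fctr \<Rightarrow> bool"
  where
  "is_language A K X Y L \<longleftrightarrow> is_functor (O_word A) K L \<and> FOb L In = X \<and> FOb L Out = Y"

definition Auto :: "'a set \<Rightarrow> ('o, 'm) cat \<Rightarrow> ('a, 'o, 'm) word_fctr \<Rightarrow>
    (('a, 'o, 'm) word_fctr, ('a, 'o, 'm) word_ntrans) cat" where
  "Auto A K L = (functor_cat (I_word A) K)
    \<lparr>Ob := {M. is_functor (I_word A) K M \<and> functor_comp (O_word A) M (word_incl A) = L},
     Ar := {\<alpha>. is_ntrans (I_word A) K \<alpha> \<and>
       whisker (O_word A) \<alpha> (word_incl A) = id_ntrans (O_word A) K L}\<rparr>"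

definition State :: "'a set \<Rightarrow> ('o, 'm) cat \<Rightarrow> ('a, 'o, 'm) word_fctr \<Rightarrow>
    (('a, 'o, 'm) word_fctr, ('a, 'o, 'm) word_ntrans, 'o, 'm) fctr" where
  "State A K L =
    \<lparr>FOb = (\<lambda>M\<in>Ob (Auto A K L). FOb M States), FAr = (\<lambda>\<alpha>\<in>Ar (Auto A K L). At \<alpha> States)\<rparr>"

text \<open>The \<open>(D, F X, Y)\<close>-language \<open>L\<^sup>*\<close> of a \<open>(C, X, G Y)\<close>-language \<open>L\<close>. The arrows of
  \<open>O_word A\<close> from \<open>In\<close> to \<open>Out\<close> are the words over \<open>A\<close> between end markers; all its other
  arrows are identities.\<close>

definition transpose_language :: "'a set \<Rightarrow> ('p, 'n) cat \<Rightarrow> ('o, 'm, 'p, 'n) fctr \<Rightarrow>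
    ('o \<Rightarrow> 'p \<Rightarrow> 'm \<Rightarrow> 'n) \<Rightarrow> 'o \<Rightarrow> 'p \<Rightarrow> ('a, 'o, 'm) word_fctr \<Rightarrow> ('a, 'p, 'n) word_fctr" where
  "transpose_language A D F \<phi> X Y L =
    \<lparr>FOb = (\<lambda>x\<in>Ob (O_word A). if x = In then FOb F X else Y),
     FAr = (\<lambda>f\<in>Ar (O_word A).
       if f \<in> hom (O_word A) In Out then \<phi> X Y (FAr L f)
       else if f = Id (O_word A) In then Id D (FOb F X)
       else Id D Y)\<rparr>"

end

theory Submission
  imports Defs
begin

text \<open>Since \<^term>\<open>I_word A\<close> is free, an automaton is a state object with an initial arrow
  \<open>s : X \<rightarrow> Q\<close>, letter arrows \<open>t\<^sub>a : Q \<rightarrow> Q\<close> and a final arrow \<open>e : Q \<rightarrow> Y\<close>, and a morphism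
  of automata is an arrow \<open>h\<close> between state objects satisfying \<open>s h = s'\<close>, \<open>t\<^sub>a h = h t'\<^sub>a\<close>,
  \<open>e = h e'\<close>. The left lift sends \<open>(Q, s, t, e)\<close> to \<open>(F Q, F s, F t, e\<^sup>*)\<close>; the right lift
  applies \<open>G\<close> to \<open>(Q, t, e)\<close> and replaces \<open>s\<close> by its transpose under the inverse bijection.
  Naturality of the adjunction bijection shows that the lifts accept the prescribed languages, and
  that \<open>h\<close> is a morphism from an automaton \<open>M\<close> to the right lift of \<open>N\<close> iff \<open>h\<^sup>*\<close> is a
  morphism from the left lift of \<open>M\<close> to \<open>N\<close>, so the bijection itself lifts.\<close>

section \<open>Hom sets and one-sided naturality of the transpose\<close>

lemma hom_iff: "f \<in> hom C x y \<longleftrightarrow> f \<in> Ar C \<and> Dom C f = x \<and> Cod C f = y"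
  by (simp add: hom_def)

context category
begin

lemma hom_Ob: "f \<in> hom C x y \<Longrightarrow> x \<in> Ob C" "f \<in> hom C x y \<Longrightarrow> y \<in> Ob C"
  using Dom_in_Ob Cod_in_Ob by (auto simp: hom_iff)

end

lemma (in is_functor) FOb_in_Ob: "x \<in> Ob C \<Longrightarrow> FOb F x \<in> Ob D"
  using FOb_ext by auto

context adjunction
begin

lemma transpose_hom:
  "\<lbrakk>f \<in> hom C X (FOb G Y); Y \<in> Ob D\<rbrakk> \<Longrightarrow> \<phi> X Y f \<in> hom D (FOb F X) Y"
  using transpose_bij[of X Y] left.dom.hom_Ob[of f] by (auto dest: bij_betwE)

lemma transpose_inject:
  "\<lbrakk>f \<in> hom C X (FOb G Y); g \<in> hom C X (FOb G Y); Y \<in> Ob D\<rbrakk> \<Longrightarrow> \<phi> X Y f = \<phi> X Y g \<longleftrightarrow> f = g"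
  using transpose_bij[of X Y] left.dom.hom_Ob[of f] by (auto dest: bij_betw_imp_inj_on inj_onD)

definition untranspose :: "'o \<Rightarrow> 'p \<Rightarrow> 'n \<Rightarrow> 'm" where
  "untranspose U V = inv_into (hom C U (FOb G V)) (\<phi> U V)"

lemma untranspose:
  assumes "g \<in> hom D (FOb F U) V" "U \<in> Ob C"
  shows "untranspose U V g \<in> hom C U (FOb G V)" "\<phi> U V (untranspose U V g) = g"
proof -
  have "g \<in> \<phi> U V ` hom C U (FOb G V)"
    using transpose_bij[of U V] left.cod.hom_Ob[of g] assms by (auto simp: bij_betw_def)
  then show "untranspose U V g \<in> hom C U (FOb G V)" "\<phi> U V (untranspose U V g) = g"
    by (simp_all add: untranspose_def inv_into_into f_inv_into_f)
qed

text \<open>Naturality with \<open>k\<close> an identity: \<open>G\<close> preserves it, so it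
  cancels on both sides.\<close>

lemma transpose_pre:
  assumes "h \<in> hom C X' X" "f \<in> hom C X (FOb G Y)" "Y \<in> Ob D"
  shows "\<phi> X' Y (h \<Zsemi>\<^bsub>C\<^esub> f) = FAr F h \<Zsemi>\<^bsub>D\<^esub> \<phi> X Y f"
proof -
  have hf: "h \<Zsemi>\<^bsub>C\<^esub> f \<in> hom C X' (FOb G Y)"
    using assms left.dom.Comp_in_hom by blast
  have "\<phi> X' Y (h \<Zsemi>\<^bsub>C\<^esub> f \<Zsemi>\<^bsub>C\<^esub> FAr G (Id D Y)) = FAr F h \<Zsemi>\<^bsub>D\<^esub> \<phi> X Y f \<Zsemi>\<^bsub>D\<^esub> Id D Y"
    using assms left.dom.hom_Ob left.cod.Id_in_hom by (intro transpose_natural) blast+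
  moreover have "FAr F h \<Zsemi>\<^bsub>D\<^esub> \<phi> X Y f \<in> hom D (FOb F X') Y"
    using assms transpose_hom left.FAr_hom left.cod.Comp_in_hom by blast
  ultimately show ?thesis
    using hf by (simp add: right.FAr_Id assms left.dom.Id_right left.cod.Id_right)
qed

text \<open>Naturality with \<open>h\<close> an identity, which \<open>F\<close> preserves.\<close>

lemma transpose_post:
  assumes "f \<in> hom C X (FOb G Y)" "k \<in> hom D Y Y'"
  shows "\<phi> X Y' (f \<Zsemi>\<^bsub>C\<^esub> FAr G k) = \<phi> X Y f \<Zsemi>\<^bsub>D\<^esub> k"
proof -
  have ob: "X \<in> Ob C" "Y \<in> Ob D" "Y' \<in> Ob D"
    using assms left.dom.hom_Ob left.cod.hom_Ob by blast+
  then have "\<phi> X Y' (Id C X \<Zsemi>\<^bsub>C\<^esub> f \<Zsemi>\<^bsub>C\<^esub> FAr G k) = FAr F (Id C X) \<Zsemi>\<^bsub>D\<^esub> \<phi> X Y f \<Zsemi>\<^bsub>D\<^esub> k"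
    using assms left.dom.Id_in_hom by (intro transpose_natural)
  then show ?thesis
    using left.cod.Id_left[OF transpose_hom] assms ob
    by (simp add: left.FAr_Id left.dom.Id_left)
qed

end

section \<open>Free categories and functors out of them\<close>

lemma path_Vert: "path Q x p y \<Longrightarrow> x \<in> Vert Q \<and> y \<in> Vert Q"
  by (induction p arbitrary: x) auto

lemma path_append: "\<lbrakk>path Q x p y; path Q y q z\<rbrakk> \<Longrightarrow> path Q x (p @ q) z"
  by (induction p arbitrary: x) auto

lemma free_cat_simps [simp]:
  "Ob (free_cat Q) = Vert Q"
  "(x, p, y) \<in> Ar (free_cat Q) \<longleftrightarrow> path Q x p y"
  "Id (free_cat Q) x = (x, [], x)"
  "(x, p, y) \<Zsemi>\<^bsub>free_cat Q\<^esub> (x', q, y') = (x, p @ q, y')"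
  "Dom (free_cat Q) (x, p, y) = x"
  "Cod (free_cat Q) (x, p, y) = y"
  by (auto simp: free_cat_def)

lemma hom_free_cat:
  "f \<in> hom (free_cat Q) x y \<longleftrightarrow> (\<exists>p. f = (x, p, y) \<and> path Q x p y)"
  by (cases f) (auto simp: hom_iff)

lemma category_free_cat: "category (free_cat Q)"
  by unfold_locales (auto simp: hom_free_cat path_append dest: path_Vert)

text \<open>The start vertex is an argument because the empty path needs an object whose identity it
  denotes. Every value carries one trailing identity, contributed by the end of the path.\<close>

fun path_val :: "('o, 'm) cat \<Rightarrow> ('v, 'e) quiver \<Rightarrow> ('v \<Rightarrow> 'o) \<Rightarrow> ('e \<Rightarrow> 'm) \<Rightarrow> 'v \<Rightarrow> 'e list \<Rightarrow> 'm" where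
  "path_val K Q u v x [] = Id K (u x)"
| "path_val K Q u v x (e # p) = v e \<Zsemi>\<^bsub>K\<^esub> path_val K Q u v (Tgt Q e) p"

text \<open>The extension of a quiver map \<open>(u, v)\<close> promised by the universal property
  of the free category, cut down to the carriers because functors are extensional here.\<close>

definition free_ext :: "('o, 'm) cat \<Rightarrow> ('v, 'e) quiver \<Rightarrow> ('v \<Rightarrow> 'o) \<Rightarrow> ('e \<Rightarrow> 'm) \<Rightarrow>
    ('v, 'v \<times> 'e list \<times> 'v, 'o, 'm) fctr" where
  "free_ext K Q u v =
    \<lparr>FOb = (\<lambda>x\<in>Vert Q. u x), FAr = (\<lambda>f\<in>Ar (free_cat Q). path_val K Q u v (fst f) (fst (snd f)))\<rparr>"

context category
begin

lemma path_val_hom: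
  assumes "\<And>x. x \<in> Vert Q \<Longrightarrow> u x \<in> Ob C"
    and "\<And>e. e \<in> Edge Q \<Longrightarrow> v e \<in> hom C (u (Src Q e)) (u (Tgt Q e))"
  shows "path Q x p y \<Longrightarrow> path_val C Q u v x p \<in> hom C (u x) (u y)"
proof (induction p arbitrary: x)
  case (Cons e p)
  then show ?case using assms(2)[of e] by (auto intro: Comp_in_hom)
qed (use assms Id_in_hom in auto)

lemma path_val_append:
  assumes "\<And>x. x \<in> Vert Q \<Longrightarrow> u x \<in> Ob C"
    and "\<And>e. e \<in> Edge Q \<Longrightarrow> v e \<in> hom C (u (Src Q e)) (u (Tgt Q e))"
    and q: "path Q y q z"
  shows "path Q x p y \<Longrightarrow>
    path_val C Q u v x (p @ q) = path_val C Q u v x p \<Zsemi>\<^bsub>C\<^esub> path_val C Q u v y q"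
proof (induction p arbitrary: x)
  case Nil
  then show ?case using Id_left[OF path_val_hom[OF assms]] by auto
next
  case (Cons e p)
  then have p: "path Q (Tgt Q e) p y" and e: "e \<in> Edge Q" by auto
  show ?case
    using Cons.IH[OF p] Comp_assoc[OF assms(2)[OF e] path_val_hom[OF assms(1,2) p]
        path_val_hom[OF assms(1,2) q]]
    by auto
qed

text \<open>The existence half of the universal property. Composition of paths is concatenation, so
  the composition law is \<open>path_val_append\<close>.\<close>

lemma is_functor_free_ext:
  assumes "\<And>x. x \<in> Vert Q \<Longrightarrow> u x \<in> Ob C"
    and "\<And>e. e \<in> Edge Q \<Longrightarrow> v e \<in> hom C (u (Src Q e)) (u (Tgt Q e))"
  shows "is_functor (free_cat Q) C (free_ext C Q u v)"
proof (intro is_functor.intro category_free_cat category_axioms is_functor_axioms.intro)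
  show "FOb (free_ext C Q u v) \<in> Ob (free_cat Q) \<rightarrow>\<^sub>E Ob C"
    using assms(1) by (auto simp: free_ext_def)
  show "FAr (free_ext C Q u v) \<in> Ar (free_cat Q) \<rightarrow>\<^sub>E Ar C"
    using path_val_hom[OF assms] by (fastforce simp: free_ext_def hom_iff)
  show "FAr (free_ext C Q u v) f \<in> hom C (FOb (free_ext C Q u v) x) (FOb (free_ext C Q u v) y)"
    if "f \<in> hom (free_cat Q) x y" for f x y
    using that path_val_hom[OF assms] by (auto simp: free_ext_def hom_free_cat dest: path_Vert)
  show "FAr (free_ext C Q u v) (Id (free_cat Q) x) = Id C (FOb (free_ext C Q u v) x)"
    if "x \<in> Ob (free_cat Q)" for x
    using that by (auto simp: free_ext_def)
  show "FAr (free_ext C Q u v) (f \<Zsemi>\<^bsub>free_cat Q\<^esub> g) =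
      FAr (free_ext C Q u v) f \<Zsemi>\<^bsub>C\<^esub> FAr (free_ext C Q u v) g"
    if "f \<in> hom (free_cat Q) x y" "g \<in> hom (free_cat Q) y z" for f g x y z
    using that path_val_append[OF assms] by (auto simp: free_ext_def hom_free_cat path_append)
qed

text \<open>A one-edge path evaluates to \<open>v e\<close> followed by the trailing identity, which
  the right unit law removes.\<close>

lemma free_ext_edge:
  assumes "v e \<in> hom C (u (Src Q e)) (u (Tgt Q e))"
    and "e \<in> Edge Q" "Src Q e \<in> Vert Q" "Tgt Q e \<in> Vert Q"
  shows "FAr (free_ext C Q u v) (Src Q e, [e], Tgt Q e) = v e"
  using assms Id_right by (auto simp: free_ext_def)

end

lemma FAr_path_Cons:
  assumes "is_functor (free_cat Q) K M" "path Q x (e # p) y"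
  shows "FAr M (x, e # p, y) = FAr M (x, [e], Tgt Q e) \<Zsemi>\<^bsub>K\<^esub> FAr M (Tgt Q e, p, y)"
proof -
  have "(x, [e], Tgt Q e) \<in> hom (free_cat Q) x (Tgt Q e)" "(Tgt Q e, p, y) \<in> hom (free_cat Q) (Tgt Q e) y"
    using assms(2) by (auto simp: hom_free_cat dest: path_Vert)
  from is_functor.FAr_Comp[OF assms(1) this] show ?thesis by simp
qed

text \<open>Naturality over a free category is decided on its generators: the square of
  \<open>e # p\<close> is the square of \<open>e\<close> pasted to the square of \<open>p\<close>.
  The components form a bare family \<open>t\<close>, so that a transformation can be built from
  them.\<close>

lemma natural_on_edges:
  assumes M: "is_functor (free_cat Q) K M" and N: "is_functor (free_cat Q) K N"
    and t: "\<And>x. x \<in> Vert Q \<Longrightarrow> t x \<in> hom K (FOb M x) (FOb N x)"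
    and nat: "\<And>e. \<lbrakk>e \<in> Edge Q; Src Q e \<in> Vert Q; Tgt Q e \<in> Vert Q\<rbrakk> \<Longrightarrow>
      FAr M (Src Q e, [e], Tgt Q e) \<Zsemi>\<^bsub>K\<^esub> t (Tgt Q e) = t (Src Q e) \<Zsemi>\<^bsub>K\<^esub> FAr N (Src Q e, [e], Tgt Q e)"
  shows "path Q x p y \<Longrightarrow> FAr M (x, p, y) \<Zsemi>\<^bsub>K\<^esub> t y = t x \<Zsemi>\<^bsub>K\<^esub> FAr N (x, p, y)"
proof (induction p arbitrary: x)
  interpret M: is_functor "free_cat Q" K M by (fact M)
  interpret N: is_functor "free_cat Q" K N by (fact N)
  {
    case Nil
    then show ?case
      using t[of x] M.FAr_Id[of x] N.FAr_Id[of x] by (auto simp: M.cod.Id_left M.cod.Id_right)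
  next
    case (Cons e p)
    then have x: "x = Src Q e" and e: "e \<in> Edge Q" "Src Q e \<in> Vert Q" "Tgt Q e \<in> Vert Q" "y \<in> Vert Q"
      and p: "path Q (Tgt Q e) p y"
      by (auto dest: path_Vert)
    let ?e = "(Src Q e, [e], Tgt Q e)" and ?p = "(Tgt Q e, p, y)"
    have eh: "?e \<in> hom (free_cat Q) (Src Q e) (Tgt Q e)" and ph: "?p \<in> hom (free_cat Q) (Tgt Q e) y"
      using e p by (auto simp: hom_free_cat)
    note assoc = M.cod.Comp_assoc
    have "FAr M (x, e # p, y) \<Zsemi>\<^bsub>K\<^esub> t y = FAr M ?e \<Zsemi>\<^bsub>K\<^esub> (FAr M ?p \<Zsemi>\<^bsub>K\<^esub> t y)"
      using assoc[OF M.FAr_hom[OF eh] M.FAr_hom[OF ph] t] e FAr_path_Cons[OF M Cons.prems] x by simp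
    also have "\<dots> = FAr M ?e \<Zsemi>\<^bsub>K\<^esub> (t (Tgt Q e) \<Zsemi>\<^bsub>K\<^esub> FAr N ?p)"
      using Cons.IH[OF p] by simp
    also have "\<dots> = t x \<Zsemi>\<^bsub>K\<^esub> FAr N ?e \<Zsemi>\<^bsub>K\<^esub> FAr N ?p"
      using assoc[OF M.FAr_hom[OF eh] t N.FAr_hom[OF ph]] e nat[OF e(1-3)] x by simp
    also have "\<dots> = t x \<Zsemi>\<^bsub>K\<^esub> FAr N (x, e # p, y)"
      using assoc[OF t N.FAr_hom[OF eh] N.FAr_hom[OF ph]] e FAr_path_Cons[OF N Cons.prems] x by simp
    finally show ?case .
  }
qed

section \<open>The word category and functors out of it\<close>

definition word_quiver :: "'a set \<Rightarrow> (word_ob, 'a word_gen) quiver" where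
  "word_quiver A =
    \<lparr>Vert = {In, States, Out}, Edge = {Start, End} \<union> Letter ` A, Src = word_src, Tgt = word_tgt\<rparr>"

text \<open>The definition of \<open>I_word\<close> contains its quiver inline; naming it makes the
  facts about free categories applicable.\<close>

lemma I_word_eq: "I_word A = free_cat (word_quiver A)"
  by (simp add: I_word_def word_quiver_def)

lemma word_quiver_simps [simp]:
  "Vert (word_quiver A) = UNIV"
  "Edge (word_quiver A) = {Start, End} \<union> Letter ` A"
  "Src (word_quiver A) = word_src"
  "Tgt (word_quiver A) = word_tgt"
  using word_ob.exhaust by (auto simp: word_quiver_def)

abbreviation gen :: "('a, 'o, 'm) word_fctr \<Rightarrow> 'a word_gen \<Rightarrow> 'm" where
  "gen M e \<equiv> FAr M (word_src e, [e], word_tgt e)"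

abbreviation word_path :: "'a set \<Rightarrow> word_ob \<Rightarrow> 'a word_gen list \<Rightarrow> word_ob \<Rightarrow> bool" where
  "word_path A \<equiv> path (word_quiver A)"

lemma word_path_from_Out: "word_path A Out p y \<longleftrightarrow> p = [] \<and> y = Out"
  by (cases p) auto

lemma word_path_to_In: "word_path A x p In \<longleftrightarrow> p = [] \<and> x = In"
proof (induction p arbitrary: x)
  case (Cons e p)
  then show ?case by (cases e) auto
qed auto

lemma word_path_from_In:
  "word_path A In p y \<longleftrightarrow> p = [] \<and> y = In \<or> (\<exists>q. p = Start # q \<and> word_path A States q y)"
  by (cases p) auto

text \<open>Peeling letters off the front of a path to \<open>Out\<close> stops at
  \<open>[End]\<close>, not at the empty path: \<open>Start\<close> does not leave
  \<open>States\<close>, and after \<open>End\<close> nothing can follow.\<close>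

lemma word_path_States_Out_induct [consumes 1, case_names End Letter]:
  assumes "word_path A States p Out"
    and "P [End]"
    and "\<And>a p. \<lbrakk>a \<in> A; word_path A States p Out; P p\<rbrakk> \<Longrightarrow> P (Letter a # p)"
  shows "P p"
  using assms(1)
proof (induction p)
  case (Cons e p)
  then show ?case using assms(2,3) by (cases e) (auto simp: word_path_from_Out)
qed simp

lemma O_word_simps [simp]:
  "Ob (O_word A) = {In, Out}"
  "Ar (O_word A) = {f \<in> Ar (I_word A). Dom (I_word A) f \<in> {In, Out} \<and> Cod (I_word A) f \<in> {In, Out}}"
  "Dom (O_word A) = Dom (I_word A)" "Cod (O_word A) = Cod (I_word A)" "Id (O_word A) = Id (I_word A)"
  by (auto simp: O_word_def full_subcat_def I_word_eq)

text \<open>No edge enters \<open>In\<close> and none leaves \<open>Out\<close>, so an arrow between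
  these two objects is an identity or a word between end markers.\<close>

lemma O_word_arrow_cases:
  assumes "f \<in> Ar (O_word A)"
  obtains "f = (In, [], In)" | "f = (Out, [], Out)"
    | p where "f = (In, Start # p, Out)" "word_path A States p Out"
  using assms
  by (cases f) (auto simp: I_word_eq word_path_from_Out word_path_to_In word_path_from_In)

text \<open>The automaton with state object \<open>q\<close>, initial arrow \<open>s\<close>, letter
  arrows \<open>t\<close> and final arrow \<open>e\<close>; the case combinators list their
  arguments in the order of the constructors.\<close>

definition word_functor :: "'a set \<Rightarrow> ('o, 'm) cat \<Rightarrow> 'o \<Rightarrow> 'o \<Rightarrow> 'o \<Rightarrow>
    'm \<Rightarrow> ('a \<Rightarrow> 'm) \<Rightarrow> 'm \<Rightarrow> ('a, 'o, 'm) word_fctr" where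
  "word_functor A K x q y s t e =
    free_ext K (word_quiver A) (case_word_ob x q y) (case_word_gen s t e)"

lemma (in category) word_functor:
  assumes "s \<in> hom C x q" "t \<in> A \<rightarrow> hom C q q" "e \<in> hom C q y"
  shows "is_functor (I_word A) C (word_functor A C x q y s t e)"
    and "FOb (word_functor A C x q y s t e) In = x"
    and "FOb (word_functor A C x q y s t e) States = q"
    and "FOb (word_functor A C x q y s t e) Out = y"
    and "FAr (word_functor A C x q y s t e) (In, [Start], States) = s"
    and "a \<in> A \<Longrightarrow> FAr (word_functor A C x q y s t e) (States, [Letter a], States) = t a"
    and "FAr (word_functor A C x q y s t e) (States, [End], Out) = e"
proof -
  let ?Q = "word_quiver A" and ?u = "case_word_ob x q y" and ?v = "case_word_gen s t e"
  have ob: "?u z \<in> Ob C" for z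
    using assms(1,3) hom_Ob by (cases z) auto
  have ed: "?v d \<in> hom C (?u (Src ?Q d)) (?u (Tgt ?Q d))" if "d \<in> Edge ?Q" for d
    using assms that by auto
  show "is_functor (I_word A) C (word_functor A C x q y s t e)"
    unfolding word_functor_def I_word_eq using ob ed by (intro is_functor_free_ext)
  note edge = free_ext_edge[where Q="?Q" and u="?u" and v="?v", OF ed]
  show "FAr (word_functor A C x q y s t e) (In, [Start], States) = s"
    using edge[of Start] by (simp add: word_functor_def)
  show "FAr (word_functor A C x q y s t e) (States, [Letter a], States) = t a" if "a \<in> A"
    using edge[of "Letter a"] that by (simp add: word_functor_def)
  show "FAr (word_functor A C x q y s t e) (States, [End], Out) = e"
    using edge[of End] by (simp add: word_functor_def)
qed (simp_all add: word_functor_def free_ext_def)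

section \<open>The category of automata for a fixed language\<close>

locale word_language =
  fixes A :: "'a set" and K :: "('o, 'm) cat" and L :: "('a, 'o, 'm) word_fctr"
  assumes language_functor: "is_functor (O_word A) K L"
begin

sublocale L: is_functor "O_word A" K L
  by (fact language_functor)

abbreviation "\<A> \<equiv> Auto A K L"

text \<open>The strict equation between functors shrinks to the ends and the words: identities agree
  because both functors preserve them, and off the carriers both sides are \<open>undefined\<close>
  by extensionality.\<close>

lemma functor_comp_incl_eq_iff:
  assumes M: "is_functor (I_word A) K M"
  shows "functor_comp (O_word A) M (word_incl A) = L \<longleftrightarrow>
    FOb M In = FOb L In \<and> FOb M Out = FOb L Out \<and>
    (\<forall>p. word_path A States p Out \<longrightarrow> FAr M (In, Start # p, Out) = FAr L (In, Start # p, Out))"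
    (is "?l \<longleftrightarrow> ?r")
proof
  have ob: "FOb (functor_comp (O_word A) M (word_incl A)) x = FOb M x" if "x \<in> Ob (O_word A)" for x
    using that by (auto simp: functor_comp_def word_incl_def inclusion_def compose_def)
  have ar: "FAr (functor_comp (O_word A) M (word_incl A)) f = FAr M f" if "f \<in> Ar (O_word A)" for f
    using that unfolding functor_comp_def word_incl_def inclusion_def compose_def by simp
  {
    assume ?l
    then show ?r using ob[of In] ob[of Out] ar[of "(In, Start # p, Out)" for p] by (auto simp: I_word_eq)
  next
    assume r: ?r
    interpret M: is_functor "I_word A" K M by (fact M)
    have "FOb (functor_comp (O_word A) M (word_incl A)) x = FOb L x" for x
    proof (cases "x \<in> Ob (O_word A)")
      case False
      then show ?thesis
        using PiE_arb[OF L.FOb_ext] by (simp add: functor_comp_def compose_def del: O_word_simps)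
    qed (use r ob in auto)
    moreover have "FAr (functor_comp (O_word A) M (word_incl A)) f = FAr L f" for f
    proof (cases "f \<in> Ar (O_word A)")
      case True
      then show ?thesis
        using r ar[OF True] M.FAr_Id[of In] M.FAr_Id[of Out] L.FAr_Id[of In] L.FAr_Id[of Out]
        by (cases rule: O_word_arrow_cases) (auto simp: I_word_eq)
    next
      case False
      then show ?thesis
        using PiE_arb[OF L.FAr_ext] by (simp add: functor_comp_def compose_def del: O_word_simps)
    qed
    ultimately show ?l by (cases L) (auto simp: functor_comp_def)
  }
qed

lemma Ob_Auto_iff:
  "M \<in> Ob \<A> \<longleftrightarrow> is_functor (I_word A) K M \<and> FOb M In = FOb L In \<and> FOb M Out = FOb L Out \<and>
    (\<forall>p. word_path A States p Out \<longrightarrow> FAr M (In, Start # p, Out) = FAr L (In, Start # p, Out))"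
  using functor_comp_incl_eq_iff by (auto simp: Auto_def)

lemma gen_hom:
  assumes "M \<in> Ob \<A>"
  shows "FAr M (In, [Start], States) \<in> hom K (FOb L In) (FOb M States)"
    and "a \<in> A \<Longrightarrow> FAr M (States, [Letter a], States) \<in> hom K (FOb M States) (FOb M States)"
    and "FAr M (States, [End], Out) \<in> hom K (FOb M States) (FOb L Out)"
proof -
  interpret M: is_functor "I_word A" K M
    using assms by (simp add: Ob_Auto_iff)
  have io: "FOb M In = FOb L In" "FOb M Out = FOb L Out"
    using assms by (simp_all add: Ob_Auto_iff)
  show "FAr M (In, [Start], States) \<in> hom K (FOb L In) (FOb M States)"
    and "a \<in> A \<Longrightarrow> FAr M (States, [Letter a], States) \<in> hom K (FOb M States) (FOb M States)"
    and "FAr M (States, [End], Out) \<in> hom K (FOb M States) (FOb L Out)"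
    unfolding io[symmetric] by (rule M.FAr_hom, simp add: I_word_eq hom_free_cat)+
qed

lemma States_in_Ob: "M \<in> Ob \<A> \<Longrightarrow> FOb M States \<in> Ob K"
  using gen_hom(1) L.cod.hom_Ob by blast

text \<open>These are the naturality squares at the generating edges, with the identity components
  at \<open>In\<close> and \<open>Out\<close> already cancelled.\<close>

definition simulation :: "('a, 'o, 'm) word_fctr \<Rightarrow> ('a, 'o, 'm) word_fctr \<Rightarrow> 'm \<Rightarrow> bool" where
  "simulation M N h \<longleftrightarrow> h \<in> hom K (FOb M States) (FOb N States) \<and>
    FAr M (In, [Start], States) \<Zsemi>\<^bsub>K\<^esub> h = FAr N (In, [Start], States) \<and>
    (\<forall>a\<in>A. FAr M (States, [Letter a], States) \<Zsemi>\<^bsub>K\<^esub> h = h \<Zsemi>\<^bsub>K\<^esub> FAr N (States, [Letter a], States)) \<and>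
    FAr M (States, [End], Out) = h \<Zsemi>\<^bsub>K\<^esub> FAr N (States, [End], Out)"

text \<open>The condition that whiskering gives the identity of \<open>L\<close> forces the
  components at \<open>In\<close> and \<open>Out\<close>. The family needs no restriction, since the
  objects of \<open>I_word A\<close> exhaust the type \<open>word_ob\<close>.\<close>

definition sim_ntrans :: "('a, 'o, 'm) word_fctr \<Rightarrow> ('a, 'o, 'm) word_fctr \<Rightarrow> 'm \<Rightarrow>
    ('a, 'o, 'm) word_ntrans" where
  "sim_ntrans M N h =
    \<lparr>NDom = M, NCod = N, At = case_word_ob (Id K (FOb L In)) h (Id K (FOb L Out))\<rparr>"

lemma sim_ntrans_simps [simp]:
  "NDom (sim_ntrans M N h) = M" "NCod (sim_ntrans M N h) = N" "At (sim_ntrans M N h) States = h"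
  by (simp_all add: sim_ntrans_def)

text \<open>By \<open>natural_on_edges\<close> only the squares of \<open>Start\<close>, the letters
  and \<open>End\<close> have to commute, and these are what a simulation provides.\<close>

lemma sim_ntrans_in_hom:
  assumes M: "M \<in> Ob \<A>" and N: "N \<in> Ob \<A>" and h: "simulation M N h"
  shows "sim_ntrans M N h \<in> hom \<A> M N"
proof -
  have fM: "is_functor (I_word A) K M" and fN: "is_functor (I_word A) K N"
    using M N by (simp_all add: Ob_Auto_iff)
  have io: "FOb M In = FOb L In" "FOb M Out = FOb L Out" "FOb N In = FOb L In" "FOb N Out = FOb L Out"
    using M N by (simp_all add: Ob_Auto_iff)
  let ?t = "At (sim_ntrans M N h)"
  have t: "?t x \<in> hom K (FOb M x) (FOb N x)" for x
    using h L.cod.Id_in_hom L.FOb_in_Ob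
    by (cases x) (auto simp: sim_ntrans_def io simulation_def)
  \<comment> \<open>The squares of \<open>Start\<close> and \<open>End\<close> each have an identity
    on one side, removed by a unit law.\<close>
  have edges: "gen M e \<Zsemi>\<^bsub>K\<^esub> ?t (word_tgt e) = ?t (word_src e) \<Zsemi>\<^bsub>K\<^esub> gen N e"
    if "e \<in> Edge (word_quiver A)" for e
    using that h L.cod.Id_left[OF gen_hom(1)[OF N]] L.cod.Id_right[OF gen_hom(3)[OF M]]
    by (auto simp: sim_ntrans_def simulation_def)
  have "FAr M f \<Zsemi>\<^bsub>K\<^esub> ?t y = ?t x \<Zsemi>\<^bsub>K\<^esub> FAr N f" if "f \<in> hom (I_word A) x y" for f x y
    using that natural_on_edges[of "word_quiver A" K M N ?t x _ y] fM fN t edges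
    by (auto simp: I_word_eq hom_free_cat)
  then have "is_ntrans (I_word A) K (sim_ntrans M N h)"
    using fM fN t
    by (intro is_ntrans.intro is_ntrans_axioms.intro) (simp_all add: I_word_eq)
  moreover have "whisker (O_word A) (sim_ntrans M N h) (word_incl A) = id_ntrans (O_word A) K L"
    using M N
    by (auto simp: whisker_def id_ntrans_def Auto_def sim_ntrans_def compose_def word_incl_def
        inclusion_def intro!: restrict_ext)
  ultimately show ?thesis
    by (simp add: hom_iff Auto_def functor_cat_def)
qed

text \<open>The whiskering equation is read three times: its source and target show that both ends
  are automata for \<open>L\<close>, and its components fix the transformation at \<open>In\<close>
  and \<open>Out\<close>, so only the component at \<open>States\<close> is free.\<close>

lemma hom_AutoE:
  assumes "\<alpha> \<in> hom \<A> M N"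
  shows "M \<in> Ob \<A>" "N \<in> Ob \<A>" "simulation M N (At \<alpha> States)"
    "\<alpha> = sim_ntrans M N (At \<alpha> States)"
proof -
  have dc: "NDom \<alpha> = M" "NCod \<alpha> = N" and nt: "is_ntrans (I_word A) K \<alpha>"
    and wh: "whisker (O_word A) \<alpha> (word_incl A) = id_ntrans (O_word A) K L"
    using assms by (auto simp: hom_iff Auto_def functor_cat_def)
  interpret \<alpha>: is_ntrans "I_word A" K \<alpha> by (fact nt)
  have "functor_comp (O_word A) M (word_incl A) = L" "functor_comp (O_word A) N (word_incl A) = L"
    using wh dc by (simp_all add: whisker_def id_ntrans_def)
  then show M: "M \<in> Ob \<A>" and N: "N \<in> Ob \<A>"
    using \<alpha>.src.is_functor_axioms \<alpha>.tgt.is_functor_axioms by (simp_all add: Auto_def dc)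
  have "At (whisker (O_word A) \<alpha> (word_incl A)) x = At (id_ntrans (O_word A) K L) x" for x
    by (simp add: wh)
  from this[of In] this[of Out]
  have ends: "At \<alpha> In = Id K (FOb L In)" "At \<alpha> Out = Id K (FOb L Out)"
    by (simp_all add: whisker_def id_ntrans_def compose_def word_incl_def inclusion_def)
  have "At \<alpha> = case_word_ob (Id K (FOb L In)) (At \<alpha> States) (Id K (FOb L Out))"
    using ends by (auto split: word_ob.split)
  then show "\<alpha> = sim_ntrans M N (At \<alpha> States)"
    using dc by (cases \<alpha>) (simp add: sim_ntrans_def)
  have edge: "gen M e \<Zsemi>\<^bsub>K\<^esub> At \<alpha> (word_tgt e) = At \<alpha> (word_src e) \<Zsemi>\<^bsub>K\<^esub> gen N e"
    if "e \<in> Edge (word_quiver A)" for e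
    using \<alpha>.At_natural[of "(word_src e, [e], word_tgt e)" "word_src e" "word_tgt e"] that
    by (simp add: dc I_word_eq hom_free_cat)
  have "At \<alpha> States \<in> hom K (FOb M States) (FOb N States)"
    using \<alpha>.At_hom[of States] by (simp add: dc I_word_eq)
  then show "simulation M N (At \<alpha> States)"
    using edge[of Start] edge[of End] edge[of "Letter a" for a] L.cod.Id_left[OF gen_hom(1)[OF N]]
      L.cod.Id_right[OF gen_hom(3)[OF M]]
    by (auto simp: simulation_def ends)
qed

text \<open>Reduces reasoning about arrows of automata to reasoning about single arrows of
  \<open>K\<close>.\<close>

lemma hom_Auto_iff:
  "\<alpha> \<in> hom \<A> M N \<longleftrightarrow>
    M \<in> Ob \<A> \<and> N \<in> Ob \<A> \<and> (\<exists>h. simulation M N h \<and> \<alpha> = sim_ntrans M N h)"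
  using hom_AutoE[of \<alpha> M N] sim_ntrans_in_hom by blast

lemma simulation_Id: "M \<in> Ob \<A> \<Longrightarrow> simulation M M (Id K (FOb M States))"
  using States_in_Ob[of M] L.cod.Id_left[OF gen_hom(2)[of M]] L.cod.Id_left[OF gen_hom(3)[of M]]
    L.cod.Id_right[OF gen_hom(1)[of M]] L.cod.Id_right[OF gen_hom(2)[of M]]
  by (auto simp: simulation_def L.cod.Id_in_hom)

lemma simulation_Comp:
  assumes M: "M \<in> Ob \<A>" and N: "N \<in> Ob \<A>" and P: "P \<in> Ob \<A>"
    and h: "simulation M N h" and k: "simulation N P k"
  shows "simulation M P (h \<Zsemi>\<^bsub>K\<^esub> k)"
proof -
  have hh: "h \<in> hom K (FOb M States) (FOb N States)" and kh: "k \<in> hom K (FOb N States) (FOb P States)"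
    using h k by (auto simp: simulation_def)
  note assoc = L.cod.Comp_assoc
  show ?thesis
    unfolding simulation_def
  proof (intro conjI ballI)
    show "h \<Zsemi>\<^bsub>K\<^esub> k \<in> hom K (FOb M States) (FOb P States)"
      using hh kh L.cod.Comp_in_hom by blast
    show "FAr M (In, [Start], States) \<Zsemi>\<^bsub>K\<^esub> (h \<Zsemi>\<^bsub>K\<^esub> k) = FAr P (In, [Start], States)"
      using assoc[OF gen_hom(1)[OF M] hh kh] h k by (simp add: simulation_def)
    show "FAr M (States, [End], Out) = h \<Zsemi>\<^bsub>K\<^esub> k \<Zsemi>\<^bsub>K\<^esub> FAr P (States, [End], Out)"
      using assoc[OF hh kh gen_hom(3)[OF P]] h k by (simp add: simulation_def)
    show "FAr M (States, [Letter a], States) \<Zsemi>\<^bsub>K\<^esub> (h \<Zsemi>\<^bsub>K\<^esub> k) =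
        h \<Zsemi>\<^bsub>K\<^esub> k \<Zsemi>\<^bsub>K\<^esub> FAr P (States, [Letter a], States)" if "a \<in> A" for a
      using assoc[OF gen_hom(2)[OF M that] hh kh] assoc[OF hh gen_hom(2)[OF N that] kh]
        assoc[OF hh kh gen_hom(2)[OF P that]] h k that
      by (simp add: simulation_def)
  qed
qed

lemma Id_Auto:
  assumes "M \<in> Ob \<A>"
  shows "Id \<A> M = sim_ntrans M M (Id K (FOb M States))"
proof -
  have "(\<lambda>x. Id K (FOb M x)) =
      case_word_ob (Id K (FOb L In)) (Id K (FOb M States)) (Id K (FOb L Out))"
    using assms by (intro ext) (simp add: Ob_Auto_iff split: word_ob.split)
  then show ?thesis
    by (simp add: Auto_def functor_cat_def id_ntrans_def sim_ntrans_def I_word_eq restrict_def)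
qed

lemma Comp_Auto:
  "sim_ntrans M N h \<Zsemi>\<^bsub>\<A>\<^esub> sim_ntrans N P k = sim_ntrans M P (h \<Zsemi>\<^bsub>K\<^esub> k)"
proof -
  have "Id K (FOb L x) \<Zsemi>\<^bsub>K\<^esub> Id K (FOb L x) = Id K (FOb L x)" if "x \<in> {In, Out}" for x
    using that L.FOb_in_Ob[of x] L.cod.Id_left[OF L.cod.Id_in_hom] by simp
  then have "(\<lambda>x. At (sim_ntrans M N h) x \<Zsemi>\<^bsub>K\<^esub> At (sim_ntrans N P k) x) =
      At (sim_ntrans M P (h \<Zsemi>\<^bsub>K\<^esub> k))"
    by (intro ext) (simp add: sim_ntrans_def split: word_ob.split)
  then show ?thesis
    by (simp add: Auto_def functor_cat_def vcomp_def I_word_eq restrict_def)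
qed

lemma Ar_Auto_hom: "\<alpha> \<in> Ar \<A> \<Longrightarrow> \<alpha> \<in> hom \<A> (NDom \<alpha>) (NCod \<alpha>)"
  by (simp add: hom_iff Auto_def functor_cat_def)

text \<open>Identities and composites are formed at \<open>States\<close>, so every law reduces to
  the same law in \<open>K\<close>, together with closure of simulations under identity and
  composition.\<close>

lemma category_Auto: "category \<A>"
proof
  fix f assume "f \<in> Ar \<A>"
  then have "f \<in> hom \<A> (Dom \<A> f) (Cod \<A> f)" by (simp add: hom_iff)
  then show "Dom \<A> f \<in> Ob \<A>" "Cod \<A> f \<in> Ob \<A>" by (auto dest: hom_AutoE)
next
  show "Id \<A> M \<in> hom \<A> M M" if "M \<in> Ob \<A>" for M
    using that by (simp add: Id_Auto sim_ntrans_in_hom simulation_Id)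
next
  show "\<alpha> \<Zsemi>\<^bsub>\<A>\<^esub> \<beta> \<in> hom \<A> M P" if "\<alpha> \<in> hom \<A> M N" "\<beta> \<in> hom \<A> N P" for \<alpha> \<beta> M N P
    using that by (auto simp: hom_Auto_iff Comp_Auto intro: simulation_Comp)
next
  show "Id \<A> M \<Zsemi>\<^bsub>\<A>\<^esub> \<alpha> = \<alpha>" "\<alpha> \<Zsemi>\<^bsub>\<A>\<^esub> Id \<A> N = \<alpha>" if "\<alpha> \<in> hom \<A> M N" for \<alpha> M N
    using that
    by (auto simp: hom_Auto_iff Comp_Auto Id_Auto simulation_def L.cod.Id_left L.cod.Id_right)
next
  show "\<alpha> \<Zsemi>\<^bsub>\<A>\<^esub> \<beta> \<Zsemi>\<^bsub>\<A>\<^esub> \<gamma> = \<alpha> \<Zsemi>\<^bsub>\<A>\<^esub> (\<beta> \<Zsemi>\<^bsub>\<A>\<^esub> \<gamma>)"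
    if "\<alpha> \<in> hom \<A> M N" "\<beta> \<in> hom \<A> N P" "\<gamma> \<in> hom \<A> P R" for \<alpha> \<beta> \<gamma> M N P R
    using that by (auto simp: hom_Auto_iff Comp_Auto simulation_def L.cod.Comp_assoc)
qed

end

section \<open>Lifting automata and simulations along the adjunction\<close>

lemma word_path_hom:
  assumes "is_functor (I_word A) K M" "word_path A x p y"
  shows "FAr M (x, p, y) \<in> hom K (FOb M x) (FOb M y)"
  using is_functor.FAr_hom[OF assms(1)] assms(2) by (auto simp: I_word_eq hom_free_cat)

lemma FAr_word_path_Cons:
  assumes "is_functor (I_word A) K M" "word_path A x (e # p) y"
  shows "FAr M (x, e # p, y) = FAr M (x, [e], word_tgt e) \<Zsemi>\<^bsub>K\<^esub> FAr M (word_tgt e, p, y)"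
  using FAr_path_Cons[of "word_quiver A"] assms by (simp add: I_word_eq)

text \<open>\<open>LD_word\<close> keeps only the values on words from the equation between
  \<open>L\<^sub>D\<close> and the transpose of \<open>L\<^sub>C\<close>; the ends are recorded
  separately.\<close>

locale language_adjunction =
  adjunction C D F G \<phi> + LC: word_language A C L\<^sub>C + LD: word_language A D L\<^sub>D
  for A :: "'a set"
    and C :: "('o, 'm) cat" and D :: "('p, 'n) cat"
    and F :: "('o, 'm, 'p, 'n) fctr" and G :: "('p, 'n, 'o, 'm) fctr"
    and \<phi> :: "'o \<Rightarrow> 'p \<Rightarrow> 'm \<Rightarrow> 'n"
    and L\<^sub>C :: "('a, 'o, 'm) word_fctr" and L\<^sub>D :: "('a, 'p, 'n) word_fctr" +
  fixes X :: 'o and Y :: 'p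
  assumes X_in_Ob: "X \<in> Ob C" and Y_in_Ob: "Y \<in> Ob D"
    and LC_ends: "FOb L\<^sub>C In = X" "FOb L\<^sub>C Out = FOb G Y"
    and LD_ends: "FOb L\<^sub>D In = FOb F X" "FOb L\<^sub>D Out = Y"
    and LD_word: "word_path A States p Out \<Longrightarrow>
      FAr L\<^sub>D (In, Start # p, Out) = \<phi> X Y (FAr L\<^sub>C (In, Start # p, Out))"
begin

abbreviation "\<A>\<^sub>C \<equiv> Auto A C L\<^sub>C"
abbreviation "\<A>\<^sub>D \<equiv> Auto A D L\<^sub>D"

definition left_ob :: "('a, 'o, 'm) word_fctr \<Rightarrow> ('a, 'p, 'n) word_fctr" where
  "left_ob M = word_functor A D (FOb F X) (FOb F (FOb M States)) Y
    (FAr F (FAr M (In, [Start], States)))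
    (\<lambda>a. FAr F (FAr M (States, [Letter a], States)))
    (\<phi> (FOb M States) Y (FAr M (States, [End], Out)))"

definition right_ob :: "('a, 'p, 'n) word_fctr \<Rightarrow> ('a, 'o, 'm) word_fctr" where
  "right_ob N = word_functor A C X (FOb G (FOb N States)) (FOb G Y)
    (untranspose X (FOb N States) (FAr N (In, [Start], States)))
    (\<lambda>a. FAr G (FAr N (States, [Letter a], States)))
    (FAr G (FAr N (States, [End], Out)))"

lemma left_ob:
  assumes M: "M \<in> Ob \<A>\<^sub>C"
  shows "is_functor (I_word A) D (left_ob M)"
    and "FOb (left_ob M) In = FOb F X"
    and "FOb (left_ob M) States = FOb F (FOb M States)"
    and "FOb (left_ob M) Out = Y"
    and "FAr (left_ob M) (In, [Start], States) = FAr F (FAr M (In, [Start], States))"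
    and "a \<in> A \<Longrightarrow> FAr (left_ob M) (States, [Letter a], States) = FAr F (FAr M (States, [Letter a], States))"
    and "FAr (left_ob M) (States, [End], Out) = \<phi> (FOb M States) Y (FAr M (States, [End], Out))"
proof -
  have "FAr F (FAr M (In, [Start], States)) \<in> hom D (FOb F X) (FOb F (FOb M States))"
    "(\<lambda>a. FAr F (FAr M (States, [Letter a], States))) \<in> A \<rightarrow> hom D (FOb F (FOb M States)) (FOb F (FOb M States))"
    "\<phi> (FOb M States) Y (FAr M (States, [End], Out)) \<in> hom D (FOb F (FOb M States)) Y"
    using LC.gen_hom[OF M] left.FAr_hom transpose_hom Y_in_Ob by (simp_all add: LC_ends)
  note * = left.cod.word_functor[OF this, folded left_ob_def]
  show "is_functor (I_word A) D (left_ob M)"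
    "FOb (left_ob M) In = FOb F X"
    "FOb (left_ob M) States = FOb F (FOb M States)"
    "FOb (left_ob M) Out = Y"
    "FAr (left_ob M) (In, [Start], States) = FAr F (FAr M (In, [Start], States))"
    "a \<in> A \<Longrightarrow> FAr (left_ob M) (States, [Letter a], States) = FAr F (FAr M (States, [Letter a], States))"
    "FAr (left_ob M) (States, [End], Out) = \<phi> (FOb M States) Y (FAr M (States, [End], Out))"
    using * by simp_all
qed

text \<open>The initial arrow is described through its transpose instead of
  \<open>untranspose\<close>, because it is compared with other arrows only after applying the
  injective \<open>\<phi>\<close>.\<close>

lemma right_ob:
  assumes N: "N \<in> Ob \<A>\<^sub>D"
  shows "is_functor (I_word A) C (right_ob N)"
    and "FOb (right_ob N) In = X"
    and "FOb (right_ob N) States = FOb G (FOb N States)"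
    and "FOb (right_ob N) Out = FOb G Y"
    and "\<phi> X (FOb N States) (FAr (right_ob N) (In, [Start], States)) = FAr N (In, [Start], States)"
    and "a \<in> A \<Longrightarrow> FAr (right_ob N) (States, [Letter a], States) = FAr G (FAr N (States, [Letter a], States))"
    and "FAr (right_ob N) (States, [End], Out) = FAr G (FAr N (States, [End], Out))"
proof -
  have start: "FAr N (In, [Start], States) \<in> hom D (FOb F X) (FOb N States)"
    using LD.gen_hom(1)[OF N] by (simp add: LD_ends)
  have "untranspose X (FOb N States) (FAr N (In, [Start], States)) \<in> hom C X (FOb G (FOb N States))"
    "(\<lambda>a. FAr G (FAr N (States, [Letter a], States))) \<in> A \<rightarrow> hom C (FOb G (FOb N States)) (FOb G (FOb N States))"
    "FAr G (FAr N (States, [End], Out)) \<in> hom C (FOb G (FOb N States)) (FOb G Y)"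
    using untranspose(1)[OF start X_in_Ob] LD.gen_hom[OF N] right.FAr_hom by (simp_all add: LD_ends)
  note * = left.dom.word_functor[OF this, folded right_ob_def]
  show "is_functor (I_word A) C (right_ob N)"
    "FOb (right_ob N) In = X"
    "FOb (right_ob N) States = FOb G (FOb N States)"
    "FOb (right_ob N) Out = FOb G Y"
    "\<phi> X (FOb N States) (FAr (right_ob N) (In, [Start], States)) = FAr N (In, [Start], States)"
    "a \<in> A \<Longrightarrow> FAr (right_ob N) (States, [Letter a], States) = FAr G (FAr N (States, [Letter a], States))"
    "FAr (right_ob N) (States, [End], Out) = FAr G (FAr N (States, [End], Out))"
    using * untranspose(2)[OF start X_in_Ob] by simp_all
qed

lemma LC_Ob:
  assumes "M \<in> Ob \<A>\<^sub>C"
  shows "is_functor (I_word A) C M" "FOb M In = X" "FOb M Out = FOb G Y"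
    "word_path A States p Out \<Longrightarrow> FAr M (In, Start # p, Out) = FAr L\<^sub>C (In, Start # p, Out)"
  using assms by (simp_all add: LC.Ob_Auto_iff LC_ends)

lemma LD_Ob:
  assumes "N \<in> Ob \<A>\<^sub>D"
  shows "is_functor (I_word A) D N" "FOb N In = FOb F X" "FOb N Out = Y"
    "word_path A States p Out \<Longrightarrow> FAr N (In, Start # p, Out) = FAr L\<^sub>D (In, Start # p, Out)"
  using assms by (simp_all add: LD.Ob_Auto_iff LD_ends)

text \<open>The final arrow is transposed from the outset, and \<open>transpose_pre\<close> absorbs
  the \<open>F\<close>-image of each preceding letter into the transpose.\<close>

lemma left_ob_suffix:
  assumes M: "M \<in> Ob \<A>\<^sub>C" and "word_path A States p Out"
  shows "FAr (left_ob M) (States, p, Out) = \<phi> (FOb M States) Y (FAr M (States, p, Out))"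
  using assms(2)
proof (induction rule: word_path_States_Out_induct)
  case End
  then show ?case using left_ob(7)[OF M] by simp
next
  case (Letter a p)
  have p: "FAr M (States, p, Out) \<in> hom C (FOb M States) (FOb G Y)"
    using word_path_hom[OF LC_Ob(1)[OF M] Letter(2)] by (simp add: LC_Ob[OF M])
  have path: "word_path A States (Letter a # p) Out"
    using Letter(1,2) by simp
  show ?case
    using FAr_word_path_Cons[OF left_ob(1)[OF M] path] FAr_word_path_Cons[OF LC_Ob(1)[OF M] path]
      transpose_pre[OF LC.gen_hom(2)[OF M Letter(1)] p Y_in_Ob] left_ob(6)[OF M Letter(1)] Letter(3)
    by simp
qed

text \<open>Functoriality of \<open>G\<close> alone, since letters and final arrow are both images
  under \<open>G\<close>.\<close>

lemma right_ob_suffix: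
  assumes N: "N \<in> Ob \<A>\<^sub>D" and "word_path A States p Out"
  shows "FAr (right_ob N) (States, p, Out) = FAr G (FAr N (States, p, Out))"
  using assms(2)
proof (induction rule: word_path_States_Out_induct)
  case End
  then show ?case using right_ob(7)[OF N] by simp
next
  case (Letter a p)
  have path: "word_path A States (Letter a # p) Out"
    using Letter(1,2) by simp
  show ?case
    using FAr_word_path_Cons[OF right_ob(1)[OF N] path] FAr_word_path_Cons[OF LD_Ob(1)[OF N] path]
      right.FAr_Comp[OF LD.gen_hom(2)[OF N Letter(1)] word_path_hom[OF LD_Ob(1)[OF N] Letter(2)]]
      right_ob(6)[OF N Letter(1)] Letter(3)
    by simp
qed

text \<open>One more use of \<open>transpose_pre\<close>, now for the initial arrow, turns the
  behaviour into the transpose of the word of \<open>L\<^sub>C\<close>, which is the word of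
  \<open>L\<^sub>D\<close>.\<close>

lemma left_ob_in_Ob:
  assumes M: "M \<in> Ob \<A>\<^sub>C"
  shows "left_ob M \<in> Ob \<A>\<^sub>D"
proof -
  have "FAr (left_ob M) (In, Start # p, Out) = FAr L\<^sub>D (In, Start # p, Out)"
    if p: "word_path A States p Out" for p
  proof -
    have path: "word_path A In (Start # p) Out" using p by simp
    have ph: "FAr M (States, p, Out) \<in> hom C (FOb M States) (FOb G Y)"
      using word_path_hom[OF LC_Ob(1)[OF M] p] by (simp add: LC_Ob[OF M])
    have sh: "FAr M (In, [Start], States) \<in> hom C X (FOb M States)"
      using LC.gen_hom(1)[OF M] by (simp add: LC_ends)
    show ?thesis
      using FAr_word_path_Cons[OF left_ob(1)[OF M] path] FAr_word_path_Cons[OF LC_Ob(1)[OF M] path]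
        left_ob(5)[OF M] left_ob_suffix[OF M p] transpose_pre[OF sh ph Y_in_Ob] LC_Ob(4)[OF M p]
        LD_word[OF p]
      by simp
  qed
  then show ?thesis
    using left_ob[OF M] by (simp add: LD.Ob_Auto_iff LD_ends)
qed

lemma right_ob_start_hom:
  assumes "N \<in> Ob \<A>\<^sub>D"
  shows "FAr (right_ob N) (In, [Start], States) \<in> hom C X (FOb G (FOb N States))"
  using word_path_hom[OF right_ob(1)[OF assms], of In "[Start]" States] right_ob[OF assms] by simp

text \<open>The initial arrow is known only through its transpose, so both words are transposed:
  \<open>transpose_post\<close> gives the word of \<open>N\<close> on one side,
  \<open>LD_word\<close> the same arrow on the other.\<close>

lemma right_ob_in_Ob:
  assumes N: "N \<in> Ob \<A>\<^sub>D"
  shows "right_ob N \<in> Ob \<A>\<^sub>C"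
proof -
  have "FAr (right_ob N) (In, Start # p, Out) = FAr L\<^sub>C (In, Start # p, Out)"
    if p: "word_path A States p Out" for p
  proof -
    have path: "word_path A In (Start # p) Out" using p by simp
    have ph: "FAr N (States, p, Out) \<in> hom D (FOb N States) Y"
      using word_path_hom[OF LD_Ob(1)[OF N] p] by (simp add: LD_Ob[OF N])
    \<comment> \<open>The transpose is injective only on the hom set, so both words must first be
      typed.\<close>
    have "(In, Start # p, Out) \<in> hom (O_word A) In Out"
      using path by (simp add: hom_iff I_word_eq)
    then have "FAr L\<^sub>C (In, Start # p, Out) \<in> hom C X (FOb G Y)"
      using LC.L.FAr_hom by (metis LC_ends)
    moreover have "FAr (right_ob N) (In, Start # p, Out) \<in> hom C X (FOb G Y)"
      using word_path_hom[OF right_ob(1)[OF N] path] right_ob[OF N] by simp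
    moreover have "\<phi> X Y (FAr (right_ob N) (In, Start # p, Out)) = \<phi> X Y (FAr L\<^sub>C (In, Start # p, Out))"
      using FAr_word_path_Cons[OF right_ob(1)[OF N] path] FAr_word_path_Cons[OF LD_Ob(1)[OF N] path]
        right_ob(5)[OF N] right_ob_suffix[OF N p] transpose_post[OF right_ob_start_hom[OF N] ph]
        LD_Ob(4)[OF N p] LD_word[OF p]
      by simp
    ultimately show ?thesis
      using transpose_inject Y_in_Ob by blast
  qed
  then show ?thesis
    using right_ob[OF N] by (simp add: LC.Ob_Auto_iff LC_ends)
qed

text \<open>Start and letters follow from functoriality of \<open>F\<close>; the final condition is
  \<open>transpose_pre\<close> applied to \<open>h\<close>.\<close>

lemma left_simulation:
  assumes M: "M \<in> Ob \<A>\<^sub>C" and N: "N \<in> Ob \<A>\<^sub>C" and h: "LC.simulation M N h"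
  shows "LD.simulation (left_ob M) (left_ob N) (FAr F h)"
proof -
  have hh: "h \<in> hom C (FOb M States) (FOb N States)"
    using h by (simp add: LC.simulation_def)
  have eN: "FAr N (States, [End], Out) \<in> hom C (FOb N States) (FOb G Y)"
    using LC.gen_hom(3)[OF N] by (simp add: LC_ends)
  have "FAr F (FAr M (States, [Letter a], States)) \<Zsemi>\<^bsub>D\<^esub> FAr F h =
      FAr F h \<Zsemi>\<^bsub>D\<^esub> FAr F (FAr N (States, [Letter a], States))" if "a \<in> A" for a
    using left.FAr_Comp[OF LC.gen_hom(2)[OF M that] hh] left.FAr_Comp[OF hh LC.gen_hom(2)[OF N that]]
      h that by (simp add: LC.simulation_def)
  then show ?thesis
    using left_ob[OF M] left_ob[OF N] left.FAr_hom[OF hh] h transpose_pre[OF hh eN Y_in_Ob]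
      left.FAr_Comp[OF LC.gen_hom(1)[OF M] hh]
    by (simp add: LC.simulation_def LD.simulation_def)
qed

text \<open>Letters and final arrow follow from functoriality of \<open>G\<close>; the initial
  condition is checked after transposing, by \<open>transpose_post\<close> and injectivity.\<close>

lemma right_simulation:
  assumes M: "M \<in> Ob \<A>\<^sub>D" and N: "N \<in> Ob \<A>\<^sub>D" and h: "LD.simulation M N h"
  shows "LC.simulation (right_ob M) (right_ob N) (FAr G h)"
proof -
  have hh: "h \<in> hom D (FOb M States) (FOb N States)"
    using h by (simp add: LD.simulation_def)
  have "FAr G (FAr M (States, [Letter a], States)) \<Zsemi>\<^bsub>C\<^esub> FAr G h =
      FAr G h \<Zsemi>\<^bsub>C\<^esub> FAr G (FAr N (States, [Letter a], States))" if "a \<in> A" for a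
    using right.FAr_Comp[OF LD.gen_hom(2)[OF M that] hh] right.FAr_Comp[OF hh LD.gen_hom(2)[OF N that]]
      h that by (simp add: LD.simulation_def)
  moreover have "FAr (right_ob M) (In, [Start], States) \<Zsemi>\<^bsub>C\<^esub> FAr G h = FAr (right_ob N) (In, [Start], States)"
  proof -
    have "FAr (right_ob M) (In, [Start], States) \<Zsemi>\<^bsub>C\<^esub> FAr G h \<in> hom C X (FOb G (FOb N States))"
      using right_ob_start_hom[OF M] right.FAr_hom[OF hh] left.dom.Comp_in_hom by blast
    moreover have "\<phi> X (FOb N States) (FAr (right_ob M) (In, [Start], States) \<Zsemi>\<^bsub>C\<^esub> FAr G h) =
        \<phi> X (FOb N States) (FAr (right_ob N) (In, [Start], States))"
      using transpose_post[OF right_ob_start_hom[OF M] hh] right_ob(5)[OF M] right_ob(5)[OF N] h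
      by (simp add: LD.simulation_def)
    ultimately show ?thesis
      using transpose_inject right_ob_start_hom[OF N] LD.States_in_Ob[OF N] by blast
  qed
  moreover have "FAr G (FAr M (States, [End], Out)) = FAr G h \<Zsemi>\<^bsub>C\<^esub> FAr G (FAr N (States, [End], Out))"
    using right.FAr_Comp[OF hh LD.gen_hom(3)[OF N]] h by (simp add: LD.simulation_def)
  ultimately show ?thesis
    using right_ob[OF M] right_ob[OF N] right.FAr_hom[OF hh]
    by (simp add: LC.simulation_def)
qed

text \<open>The conditions correspond one by one: start by \<open>transpose_pre\<close>, end by
  \<open>transpose_post\<close>, letters by both. Injectivity of the transpose makes each an
  equivalence.\<close>

lemma transpose_simulation_iff:
  assumes M: "M \<in> Ob \<A>\<^sub>C" and N: "N \<in> Ob \<A>\<^sub>D"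
    and h: "h \<in> hom C (FOb M States) (FOb G (FOb N States))"
  shows "LD.simulation (left_ob M) N (\<phi> (FOb M States) (FOb N States) h) \<longleftrightarrow>
    LC.simulation M (right_ob N) h"
proof -
  let ?S = "FOb M States" and ?T = "FOb N States"
  have T: "?T \<in> Ob D" using LD.States_in_Ob[OF N] .
  have sM: "FAr M (In, [Start], States) \<in> hom C X ?S" and eM: "FAr M (States, [End], Out) \<in> hom C ?S (FOb G Y)"
    using LC.gen_hom[OF M] by (simp_all add: LC_ends)
  have eN: "FAr N (States, [End], Out) \<in> hom D ?T Y"
    using LD.gen_hom(3)[OF N] by (simp add: LD_ends)
  note comp = left.dom.Comp_in_hom
  have "FAr F (FAr M (In, [Start], States)) \<Zsemi>\<^bsub>D\<^esub> \<phi> ?S ?T h = FAr N (In, [Start], States) \<longleftrightarrow>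
      FAr M (In, [Start], States) \<Zsemi>\<^bsub>C\<^esub> h = FAr (right_ob N) (In, [Start], States)"
    using transpose_pre[OF sM h T] right_ob(5)[OF N]
      transpose_inject[OF comp[OF sM h] right_ob_start_hom[OF N] T] by simp
  moreover have "FAr F (FAr M (States, [Letter a], States)) \<Zsemi>\<^bsub>D\<^esub> \<phi> ?S ?T h =
        \<phi> ?S ?T h \<Zsemi>\<^bsub>D\<^esub> FAr N (States, [Letter a], States) \<longleftrightarrow>
      FAr M (States, [Letter a], States) \<Zsemi>\<^bsub>C\<^esub> h = h \<Zsemi>\<^bsub>C\<^esub> FAr G (FAr N (States, [Letter a], States))"
    if a: "a \<in> A" for a
  proof -
    note aM = LC.gen_hom(2)[OF M a] and aN = LD.gen_hom(2)[OF N a]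
    show ?thesis
      using transpose_pre[OF aM h T] transpose_post[OF h aN]
        transpose_inject[OF comp[OF aM h] comp[OF h right.FAr_hom[OF aN]] T] by simp
  qed
  moreover have "\<phi> ?S Y (FAr M (States, [End], Out)) = \<phi> ?S ?T h \<Zsemi>\<^bsub>D\<^esub> FAr N (States, [End], Out) \<longleftrightarrow>
      FAr M (States, [End], Out) = h \<Zsemi>\<^bsub>C\<^esub> FAr G (FAr N (States, [End], Out))"
    using transpose_post[OF h eN] transpose_inject[OF eM comp[OF h right.FAr_hom[OF eN]] Y_in_Ob]
    by simp
  ultimately show ?thesis
    using left_ob[OF M] right_ob[OF N] h transpose_hom[OF h T]
    by (simp add: LC.simulation_def LD.simulation_def)
qed

section \<open>The lifted functors and the lifted bijection\<close>

definition left_lift ::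
    "(('a, 'o, 'm) word_fctr, ('a, 'o, 'm) word_ntrans, ('a, 'p, 'n) word_fctr, ('a, 'p, 'n) word_ntrans) fctr" where
  "left_lift = \<lparr>FOb = (\<lambda>M\<in>Ob \<A>\<^sub>C. left_ob M),
    FAr = (\<lambda>\<alpha>\<in>Ar \<A>\<^sub>C. LD.sim_ntrans (left_ob (NDom \<alpha>)) (left_ob (NCod \<alpha>)) (FAr F (At \<alpha> States)))\<rparr>"

definition right_lift ::
    "(('a, 'p, 'n) word_fctr, ('a, 'p, 'n) word_ntrans, ('a, 'o, 'm) word_fctr, ('a, 'o, 'm) word_ntrans) fctr" where
  "right_lift = \<lparr>FOb = (\<lambda>N\<in>Ob \<A>\<^sub>D. right_ob N),
    FAr = (\<lambda>\<alpha>\<in>Ar \<A>\<^sub>D. LC.sim_ntrans (right_ob (NDom \<alpha>)) (right_ob (NCod \<alpha>)) (FAr G (At \<alpha> States)))\<rparr>"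

lemma left_lift_FOb: "M \<in> Ob \<A>\<^sub>C \<Longrightarrow> FOb left_lift M = left_ob M"
  by (simp add: left_lift_def)

lemma right_lift_FOb: "N \<in> Ob \<A>\<^sub>D \<Longrightarrow> FOb right_lift N = right_ob N"
  by (simp add: right_lift_def)

lemma left_lift_FAr:
  assumes "M \<in> Ob \<A>\<^sub>C" "N \<in> Ob \<A>\<^sub>C" "LC.simulation M N h"
  shows "FAr left_lift (LC.sim_ntrans M N h) = LD.sim_ntrans (left_ob M) (left_ob N) (FAr F h)"
  using LC.sim_ntrans_in_hom[OF assms] by (simp add: left_lift_def hom_iff)

lemma right_lift_FAr:
  assumes "M \<in> Ob \<A>\<^sub>D" "N \<in> Ob \<A>\<^sub>D" "LD.simulation M N h"
  shows "FAr right_lift (LD.sim_ntrans M N h) = LC.sim_ntrans (right_ob M) (right_ob N) (FAr G h)"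
  using LD.sim_ntrans_in_hom[OF assms] by (simp add: right_lift_def hom_iff)

text \<open>Arrows of automata are determined at \<open>States\<close>, so the functor laws are
  those of \<open>F\<close>.\<close>

lemma is_functor_left_lift: "is_functor \<A>\<^sub>C \<A>\<^sub>D left_lift"
proof (intro is_functor.intro LC.category_Auto LD.category_Auto is_functor_axioms.intro)
  show hom: "FAr left_lift \<alpha> \<in> hom \<A>\<^sub>D (FOb left_lift M) (FOb left_lift N)"
    if "\<alpha> \<in> hom \<A>\<^sub>C M N" for \<alpha> M N
    using that left_simulation LD.sim_ntrans_in_hom left_ob_in_Ob
    by (auto simp: LC.hom_Auto_iff left_lift_FOb left_lift_FAr)
  show "FOb left_lift \<in> Ob \<A>\<^sub>C \<rightarrow>\<^sub>E Ob \<A>\<^sub>D"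
    by (auto simp: left_lift_def left_ob_in_Ob)
  have "FAr left_lift \<alpha> \<in> Ar \<A>\<^sub>D" if "\<alpha> \<in> Ar \<A>\<^sub>C" for \<alpha>
    using hom[OF LC.Ar_Auto_hom[OF that]] by (simp add: hom_iff)
  then show "FAr left_lift \<in> Ar \<A>\<^sub>C \<rightarrow>\<^sub>E Ar \<A>\<^sub>D"
    by (intro PiE_I) (simp_all add: left_lift_def)
  show "FAr left_lift (Id \<A>\<^sub>C M) = Id \<A>\<^sub>D (FOb left_lift M)" if M: "M \<in> Ob \<A>\<^sub>C" for M
    using M LC.States_in_Ob[OF M] left_ob(3)[OF M]
    by (simp add: LC.Id_Auto LD.Id_Auto left_lift_FAr left_lift_FOb LC.simulation_Id left_ob_in_Ob
        left.FAr_Id)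
  show "FAr left_lift (\<alpha> \<Zsemi>\<^bsub>\<A>\<^sub>C\<^esub> \<beta>) = FAr left_lift \<alpha> \<Zsemi>\<^bsub>\<A>\<^sub>D\<^esub> FAr left_lift \<beta>"
    if \<alpha>: "\<alpha> \<in> hom \<A>\<^sub>C M N" and \<beta>: "\<beta> \<in> hom \<A>\<^sub>C N P" for \<alpha> \<beta> M N P
  proof -
    obtain h k where h: "LC.simulation M N h" "\<alpha> = LC.sim_ntrans M N h"
      and k: "LC.simulation N P k" "\<beta> = LC.sim_ntrans N P k"
      and ob: "M \<in> Ob \<A>\<^sub>C" "N \<in> Ob \<A>\<^sub>C" "P \<in> Ob \<A>\<^sub>C"
      using \<alpha> \<beta> by (auto simp: LC.hom_Auto_iff)
    have "FAr F (h \<Zsemi>\<^bsub>C\<^esub> k) = FAr F h \<Zsemi>\<^bsub>D\<^esub> FAr F k"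
      using h(1) k(1) left.FAr_Comp by (auto simp: LC.simulation_def)
    then show ?thesis
      using h k ob LC.simulation_Comp[OF ob h(1) k(1)]
      by (simp add: LC.Comp_Auto LD.Comp_Auto left_lift_FAr)
  qed
qed

lemma is_functor_right_lift: "is_functor \<A>\<^sub>D \<A>\<^sub>C right_lift"
proof (intro is_functor.intro LC.category_Auto LD.category_Auto is_functor_axioms.intro)
  show hom: "FAr right_lift \<alpha> \<in> hom \<A>\<^sub>C (FOb right_lift M) (FOb right_lift N)"
    if "\<alpha> \<in> hom \<A>\<^sub>D M N" for \<alpha> M N
    using that right_simulation LC.sim_ntrans_in_hom right_ob_in_Ob
    by (auto simp: LD.hom_Auto_iff right_lift_FOb right_lift_FAr)
  show "FOb right_lift \<in> Ob \<A>\<^sub>D \<rightarrow>\<^sub>E Ob \<A>\<^sub>C"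
    by (auto simp: right_lift_def right_ob_in_Ob)
  have "FAr right_lift \<alpha> \<in> Ar \<A>\<^sub>C" if "\<alpha> \<in> Ar \<A>\<^sub>D" for \<alpha>
    using hom[OF LD.Ar_Auto_hom[OF that]] by (simp add: hom_iff)
  then show "FAr right_lift \<in> Ar \<A>\<^sub>D \<rightarrow>\<^sub>E Ar \<A>\<^sub>C"
    by (intro PiE_I) (simp_all add: right_lift_def)
  show "FAr right_lift (Id \<A>\<^sub>D M) = Id \<A>\<^sub>C (FOb right_lift M)" if M: "M \<in> Ob \<A>\<^sub>D" for M
    using M LD.States_in_Ob[OF M] right_ob(3)[OF M]
    by (simp add: LD.Id_Auto LC.Id_Auto right_lift_FAr right_lift_FOb LD.simulation_Id right_ob_in_Ob
        right.FAr_Id)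
  show "FAr right_lift (\<alpha> \<Zsemi>\<^bsub>\<A>\<^sub>D\<^esub> \<beta>) = FAr right_lift \<alpha> \<Zsemi>\<^bsub>\<A>\<^sub>C\<^esub> FAr right_lift \<beta>"
    if \<alpha>: "\<alpha> \<in> hom \<A>\<^sub>D M N" and \<beta>: "\<beta> \<in> hom \<A>\<^sub>D N P" for \<alpha> \<beta> M N P
  proof -
    obtain h k where h: "LD.simulation M N h" "\<alpha> = LD.sim_ntrans M N h"
      and k: "LD.simulation N P k" "\<beta> = LD.sim_ntrans N P k"
      and ob: "M \<in> Ob \<A>\<^sub>D" "N \<in> Ob \<A>\<^sub>D" "P \<in> Ob \<A>\<^sub>D"
      using \<alpha> \<beta> by (auto simp: LD.hom_Auto_iff)
    have "FAr G (h \<Zsemi>\<^bsub>D\<^esub> k) = FAr G h \<Zsemi>\<^bsub>C\<^esub> FAr G k"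
      using h(1) k(1) right.FAr_Comp by (auto simp: LD.simulation_def)
    then show ?thesis
      using h k ob LD.simulation_Comp[OF ob h(1) k(1)]
      by (simp add: LC.Comp_Auto LD.Comp_Auto right_lift_FAr)
  qed
qed

text \<open>Left unrestricted, as \<open>adjunction\<close> constrains its bijections only on hom
  sets.\<close>

definition transpose_lift :: "('a, 'o, 'm) word_fctr \<Rightarrow> ('a, 'p, 'n) word_fctr \<Rightarrow>
    ('a, 'o, 'm) word_ntrans \<Rightarrow> ('a, 'p, 'n) word_ntrans" where
  "transpose_lift M N \<alpha> =
    LD.sim_ntrans (left_ob M) N (\<phi> (FOb M States) (FOb N States) (At \<alpha> States))"

text \<open>Injectivity is that of \<open>\<phi>\<close> at \<open>States\<close>. For surjectivity,
  the preimage of the component at \<open>States\<close> under \<open>\<phi>\<close> is again a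
  simulation by \<open>transpose_simulation_iff\<close>.\<close>

lemma transpose_lift_bij:
  assumes M: "M \<in> Ob \<A>\<^sub>C" and N: "N \<in> Ob \<A>\<^sub>D"
  shows "bij_betw (transpose_lift M N) (hom \<A>\<^sub>C M (right_ob N)) (hom \<A>\<^sub>D (left_ob M) N)"
proof -
  let ?S = "FOb M States" and ?T = "FOb N States"
  have T: "?T \<in> Ob D" and S: "?S \<in> Ob C"
    using LD.States_in_Ob[OF N] LC.States_in_Ob[OF M] .
  have sim_hom: "h \<in> hom C ?S (FOb G ?T)" if "LC.simulation M (right_ob N) h" for h
    using that right_ob(3)[OF N] by (simp add: LC.simulation_def)
  show ?thesis
  proof (intro bij_betw_imageI inj_onI equalityI subsetI)
    fix \<alpha> \<beta>
    assume *: "\<alpha> \<in> hom \<A>\<^sub>C M (right_ob N)" "\<beta> \<in> hom \<A>\<^sub>C M (right_ob N)"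
      and eq: "transpose_lift M N \<alpha> = transpose_lift M N \<beta>"
    have "\<phi> ?S ?T (At \<alpha> States) = \<phi> ?S ?T (At \<beta> States)"
      using arg_cong[OF eq, of "\<lambda>\<gamma>. At \<gamma> States"] by (simp add: transpose_lift_def)
    then have "At \<alpha> States = At \<beta> States"
      using transpose_inject[OF sim_hom sim_hom T] LC.hom_AutoE(3)[OF *(1)] LC.hom_AutoE(3)[OF *(2)]
      by blast
    then show "\<alpha> = \<beta>"
      using LC.hom_AutoE(4)[OF *(1)] LC.hom_AutoE(4)[OF *(2)] by simp
  next
    fix \<beta> assume "\<beta> \<in> transpose_lift M N ` hom \<A>\<^sub>C M (right_ob N)"
    then obtain \<alpha> where \<alpha>: "\<alpha> \<in> hom \<A>\<^sub>C M (right_ob N)" and \<beta>: "\<beta> = transpose_lift M N \<alpha>" by blast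
    have "LC.simulation M (right_ob N) (At \<alpha> States)"
      using LC.hom_AutoE(3)[OF \<alpha>] .
    then show "\<beta> \<in> hom \<A>\<^sub>D (left_ob M) N"
      using transpose_simulation_iff[OF M N sim_hom] LD.sim_ntrans_in_hom[OF left_ob_in_Ob[OF M] N]
      by (simp add: \<beta> transpose_lift_def)
  next
    fix \<beta> assume \<beta>: "\<beta> \<in> hom \<A>\<^sub>D (left_ob M) N"
    have sim: "LD.simulation (left_ob M) N (At \<beta> States)"
      using LD.hom_AutoE(3)[OF \<beta>] .
    then have "At \<beta> States \<in> hom D (FOb F ?S) ?T"
      using left_ob(3)[OF M] by (simp add: LD.simulation_def)
    then obtain h where h: "h \<in> hom C ?S (FOb G ?T)" "\<phi> ?S ?T h = At \<beta> States"
      using untranspose S by metis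
    then have "LC.simulation M (right_ob N) h"
      using transpose_simulation_iff[OF M N h(1)] sim by simp
    then have "LC.sim_ntrans M (right_ob N) h \<in> hom \<A>\<^sub>C M (right_ob N)"
      using LC.sim_ntrans_in_hom M right_ob_in_Ob[OF N] by blast
    moreover have "transpose_lift M N (LC.sim_ntrans M (right_ob N) h) = \<beta>"
      using LD.hom_AutoE(4)[OF \<beta>] h(2) by (simp add: transpose_lift_def)
    ultimately show "\<beta> \<in> transpose_lift M N ` hom \<A>\<^sub>C M (right_ob N)"
      by (metis imageI)
  qed
qed

text \<open>Both sides are simulations between the same automata, and at \<open>States\<close> the
  equation is naturality of \<open>\<phi>\<close>.\<close>

lemma transpose_lift_natural:
  assumes M: "M \<in> Ob \<A>\<^sub>C" and M': "M' \<in> Ob \<A>\<^sub>C" and N: "N \<in> Ob \<A>\<^sub>D" and N': "N' \<in> Ob \<A>\<^sub>D"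
    and \<alpha>: "\<alpha> \<in> hom \<A>\<^sub>C M' M" and \<beta>: "\<beta> \<in> hom \<A>\<^sub>C M (right_ob N)" and \<gamma>: "\<gamma> \<in> hom \<A>\<^sub>D N N'"
  shows "transpose_lift M' N' (\<alpha> \<Zsemi>\<^bsub>\<A>\<^sub>C\<^esub> \<beta> \<Zsemi>\<^bsub>\<A>\<^sub>C\<^esub> FAr right_lift \<gamma>) =
    FAr left_lift \<alpha> \<Zsemi>\<^bsub>\<A>\<^sub>D\<^esub> transpose_lift M N \<beta> \<Zsemi>\<^bsub>\<A>\<^sub>D\<^esub> \<gamma>"
proof -
  obtain h f k where h: "LC.simulation M' M h" "\<alpha> = LC.sim_ntrans M' M h"
    and f: "LC.simulation M (right_ob N) f" "\<beta> = LC.sim_ntrans M (right_ob N) f"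
    and k: "LD.simulation N N' k" "\<gamma> = LD.sim_ntrans N N' k"
    using \<alpha> \<beta> \<gamma> by (auto simp: LC.hom_Auto_iff LD.hom_Auto_iff)
  have "\<phi> (FOb M' States) (FOb N' States) (h \<Zsemi>\<^bsub>C\<^esub> f \<Zsemi>\<^bsub>C\<^esub> FAr G k) =
      FAr F h \<Zsemi>\<^bsub>D\<^esub> \<phi> (FOb M States) (FOb N States) f \<Zsemi>\<^bsub>D\<^esub> k"
    using h(1) f(1) k(1) LC.States_in_Ob[OF M] LC.States_in_Ob[OF M'] LD.States_in_Ob[OF N]
      LD.States_in_Ob[OF N'] right_ob(3)[OF N]
    by (intro transpose_natural) (simp_all add: LC.simulation_def LD.simulation_def)
  then show ?thesis
    using h f k M M' N N'
    by (simp add: transpose_lift_def left_lift_FAr right_lift_FAr LC.Comp_Auto LD.Comp_Auto)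
qed

lemma adjunction_lift: "adjunction \<A>\<^sub>C \<A>\<^sub>D left_lift right_lift transpose_lift"
  by (intro adjunction.intro is_functor_left_lift is_functor_right_lift adjunction_axioms.intro)
    (simp_all add: left_lift_FOb right_lift_FOb transpose_lift_bij transpose_lift_natural)

section \<open>Compatibility with the state functors\<close>

lemma State_left_lift:
  "functor_comp \<A>\<^sub>C (State A D L\<^sub>D) left_lift = functor_comp \<A>\<^sub>C F (State A C L\<^sub>C)"
proof -
  have "FOb (State A D L\<^sub>D) (FOb left_lift M) = FOb F (FOb (State A C L\<^sub>C) M)" if "M \<in> Ob \<A>\<^sub>C" for M
    using that left_ob(3) left_ob_in_Ob by (simp add: State_def left_lift_FOb)
  moreover have "FAr (State A D L\<^sub>D) (FAr left_lift \<alpha>) = FAr F (FAr (State A C L\<^sub>C) \<alpha>)"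
    if \<alpha>: "\<alpha> \<in> Ar \<A>\<^sub>C" for \<alpha>
  proof -
    have "FAr left_lift \<alpha> \<in> Ar \<A>\<^sub>D"
      using is_functor.FAr_ext[OF is_functor_left_lift] \<alpha> by auto
    then show ?thesis
      \<comment> \<open>The order of unfolding matters: the restriction in \<open>State\<close> is
        resolved by the membership just shown, which mentions \<open>left_lift\<close> in folded
        form.\<close>
      using \<alpha> by (simp add: State_def) (simp add: left_lift_def)
  qed
  ultimately show ?thesis
    by (auto simp: functor_comp_def compose_def intro!: restrict_ext)
qed

lemma State_right_lift:
  "functor_comp \<A>\<^sub>D (State A C L\<^sub>C) right_lift = functor_comp \<A>\<^sub>D G (State A D L\<^sub>D)"
proof -
  have "FOb (State A C L\<^sub>C) (FOb right_lift N) = FOb G (FOb (State A D L\<^sub>D) N)" if "N \<in> Ob \<A>\<^sub>D" for N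
    using that right_ob(3) right_ob_in_Ob by (simp add: State_def right_lift_FOb)
  moreover have "FAr (State A C L\<^sub>C) (FAr right_lift \<alpha>) = FAr G (FAr (State A D L\<^sub>D) \<alpha>)"
    if \<alpha>: "\<alpha> \<in> Ar \<A>\<^sub>D" for \<alpha>
  proof -
    have "FAr right_lift \<alpha> \<in> Ar \<A>\<^sub>C"
      using is_functor.FAr_ext[OF is_functor_right_lift] \<alpha> by auto
    then show ?thesis
      using \<alpha> by (simp add: State_def) (simp add: right_lift_def)
  qed
  ultimately show ?thesis
    by (auto simp: functor_comp_def compose_def intro!: restrict_ext)
qed

lemma State_transpose_lift:
  assumes M: "M \<in> Ob \<A>\<^sub>C" and N: "N \<in> Ob \<A>\<^sub>D" and \<alpha>: "\<alpha> \<in> hom \<A>\<^sub>C M (FOb right_lift N)"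
  shows "FAr (State A D L\<^sub>D) (transpose_lift M N \<alpha>) =
    \<phi> (FOb (State A C L\<^sub>C) M) (FOb (State A D L\<^sub>D) N) (FAr (State A C L\<^sub>C) \<alpha>)"
proof -
  have "transpose_lift M N \<alpha> \<in> Ar \<A>\<^sub>D"
    using bij_betwE[OF transpose_lift_bij[OF M N]] \<alpha> by (auto simp: right_lift_FOb N hom_iff)
  moreover have "\<alpha> \<in> Ar \<A>\<^sub>C" using \<alpha> by (simp add: hom_iff)
  ultimately show ?thesis
    \<comment> \<open>Again \<open>State\<close> is evaluated while \<open>transpose_lift\<close> is
      still folded.\<close>
    using M N by (simp add: State_def) (simp add: transpose_lift_def)
qed

end

text \<open>The last conjunct says that the adjunction itself is lifted, beyond the two functors: on
  state objects the new bijection is \<open>\<phi>\<close>.\<close>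

theorem lemma3p4:
  fixes A :: "'a set"
    and C :: "('o, 'm) cat" and D :: "('p, 'n) cat"
    and F :: "('o, 'm, 'p, 'n) fctr" and G :: "('p, 'n, 'o, 'm) fctr"
    and \<phi> :: "'o \<Rightarrow> 'p \<Rightarrow> 'm \<Rightarrow> 'n"
    and X :: 'o and Y :: 'p
    and L\<^sub>C :: "('a, 'o, 'm) word_fctr" and L\<^sub>D :: "('a, 'p, 'n) word_fctr"
  assumes "adjunction C D F G \<phi>"
    and "X \<in> Ob C" and "Y \<in> Ob D"
    and "is_language A C X (FOb G Y) L\<^sub>C"
    and "is_language A D (FOb F X) Y L\<^sub>D"
    and "L\<^sub>D = transpose_language A D F \<phi> X Y L\<^sub>C"
  shows "\<exists>F' G' \<phi>'.
    adjunction (Auto A C L\<^sub>C) (Auto A D L\<^sub>D) F' G' \<phi>' \<and>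
    functor_comp (Auto A C L\<^sub>C) (State A D L\<^sub>D) F' = functor_comp (Auto A C L\<^sub>C) F (State A C L\<^sub>C) \<and>
    functor_comp (Auto A D L\<^sub>D) (State A C L\<^sub>C) G' = functor_comp (Auto A D L\<^sub>D) G (State A D L\<^sub>D) \<and>
    (\<forall>M\<in>Ob (Auto A C L\<^sub>C). \<forall>N\<in>Ob (Auto A D L\<^sub>D). \<forall>\<alpha>\<in>hom (Auto A C L\<^sub>C) M (FOb G' N).
      FAr (State A D L\<^sub>D) (\<phi>' M N \<alpha>) =
        \<phi> (FOb (State A C L\<^sub>C) M) (FOb (State A D L\<^sub>D) N) (FAr (State A C L\<^sub>C) \<alpha>))"
proof -
  have LC: "is_functor (O_word A) C L\<^sub>C" "FOb L\<^sub>C In = X" "FOb L\<^sub>C Out = FOb G Y"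
    and LD: "is_functor (O_word A) D L\<^sub>D" "FOb L\<^sub>D In = FOb F X" "FOb L\<^sub>D Out = Y"
    using assms(4,5) by (simp_all add: is_language_def)
  have "FAr L\<^sub>D (In, Start # p, Out) = \<phi> X Y (FAr L\<^sub>C (In, Start # p, Out))"
    if "word_path A States p Out" for p
  proof -
    \<comment> \<open>Selects the branch of \<open>transpose_language\<close> in which
      \<open>\<phi>\<close> is applied.\<close>
    have "(In, Start # p, Out) \<in> hom (O_word A) In Out"
      using that by (simp add: hom_iff I_word_eq)
    moreover from this have "(In, Start # p, Out) \<in> Ar (O_word A)"
      by (simp add: hom_iff)
    ultimately show ?thesis
      unfolding assms(6) transpose_language_def by simp
  qed
  then interpret language_adjunction A C D F G \<phi> L\<^sub>C L\<^sub>D X Y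
    using assms(1-3) LC LD
    by (intro language_adjunction.intro word_language.intro language_adjunction_axioms.intro)
  show ?thesis
    using adjunction_lift State_left_lift State_right_lift State_transpose_lift by blast
qed

end
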